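(* Let $s,t$ be real numbers with $t\geqslant 7$, and let $\Gamma$ be a connected nonregular graph whose adjacency matrix has precisely the three distinct eigenvalues $s>1>-t$, such that $\Gamma$ is not a cone and $\Gamma$ is not biregular. Then the minimum valency of $\Gamma$ satisfies $\delta(\Gamma)\geqslant t+2$.
   Context: A graph on $n$ vertices is a cone if it has a vertex of degree $n-1$. A graph is biregular if it has precisely two distinct vertex valencies. $\delta(\Gamma)$ denotes the smallest valency of $\Gamma$. *)

theory Defs
  imports "Graph_Theory.Digraph_Component" "Jordan_Normal_Form.Spectral_Radius"
begin

text \<open>Simple graphs are the finite loop-free symmetric digraphs of locale \<^locale>\<open>graph\<close>:
  an edge is a pair of opposite arcs, so the valency of a vertex is its out-degree.\<close>

definition valencies :: "('a, 'b) pre_digraph \<Rightarrow> nat set" where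
  "valencies G = out_degree G ` verts G"

definition min_valency :: "('a, 'b) pre_digraph \<Rightarrow> nat" where
  "min_valency G = Min (valencies G)"

definition regular_graph :: "('a, 'b) pre_digraph \<Rightarrow> bool" where
  "regular_graph G \<longleftrightarrow> (\<exists>k. \<forall>v\<in>verts G. out_degree G v = k)"

definition biregular_graph :: "('a, 'b) pre_digraph \<Rightarrow> bool" where
  "biregular_graph G \<longleftrightarrow> card (valencies G) = 2"

definition cone_graph :: "('a, 'b) pre_digraph \<Rightarrow> bool" where
  "cone_graph G \<longleftrightarrow> (\<exists>v\<in>verts G. out_degree G v = card (verts G) - 1)"

text \<open>Rows and columns are indexed by an enumeration \<open>vs\<close> of the vertices. A different
  enumeration conjugates the matrix by a permutation matrix, so its eigenvalues depend only on
  the graph.\<close>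

definition vertex_enumeration :: "('a, 'b) pre_digraph \<Rightarrow> 'a list \<Rightarrow> bool" where
  "vertex_enumeration G vs \<longleftrightarrow> distinct vs \<and> set vs = verts G"

definition adjacency_matrix :: "('a, 'b) pre_digraph \<Rightarrow> 'a list \<Rightarrow> real mat" where
  "adjacency_matrix G vs =
     Matrix.mat (length vs) (length vs)
       (\<lambda>(i, j). if vs ! i \<rightarrow>\<^bsub>G\<^esub> vs ! j then 1 else 0)"

end

theory Submission
  imports Defs "HOL-Analysis.Function_Topology"
begin

text \<open>
  Since \<open>s\<close> is a simple eigenvalue, \<open>A\<^sup>2 + (t - 1)A - tI\<close> has rank one and equals \<open>\<alpha>\<alpha>\<^sup>T\<close> for a
  positive Perron vector \<open>\<alpha>\<close>. Hence every vertex \<open>u\<close> has valency \<open>t + \<alpha>\<^sub>u\<^sup>2\<close>, and two vertices \<open>u\<close>,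
  \<open>v\<close> have \<open>\<alpha>\<^sub>u\<alpha>\<^sub>v\<close> common neighbours if they are not adjacent and \<open>\<alpha>\<^sub>u\<alpha>\<^sub>v + 1 - t\<close> if they are.
  Comparing these integers on an adjacent and on a nonadjacent pair shows that \<open>t\<close> is rational and
  a root of a monic integer quadratic, hence an integer. If the minimum valency is below \<open>t + 2\<close>,
  some vertex \<open>x\<close> has \<open>\<alpha>\<^sub>x = 1\<close> and all \<open>\<alpha>\<^sub>v\<close> are integers. As \<open>u\<close> has only
  \<open>t + \<alpha>\<^sub>u(\<alpha>\<^sub>u - \<alpha>\<^sub>v)\<close> neighbours outside the neighbourhood of a nonadjacent \<open>v\<close>, the values of \<open>\<alpha>\<close>
  on the \<open>t + 1\<close> neighbours of \<open>x\<close> differ by at most one, lie in \<open>{t - 1, t, t + 1}\<close>, and nearly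
  determine the values on the remaining vertices. Counting then excludes everything except
  \<open>\<alpha> \<in> {1, c}\<close>, that is, at most two valencies.
\<close>

section \<open>Symmetric kernels on a finite set\<close>

lemma nonneg_quadratic_linear_coeff:
  fixes b c :: real
  assumes "\<And>e. 0 \<le> 2 * e * b + e\<^sup>2 * c"
  shows "b = 0"
proof (rule ccontr)
  assume "b \<noteq> 0"
  \<comment> \<open>\<open>K\<close> is positive and exceeds \<open>c\<close>, so at
    \<open>e = - b / K\<close> the linear term outweighs the quadratic one and the sum is
    negative.\<close>
  define K where "K = \<bar>c\<bar> + 1"
  have K: "K > 0" "c < K" by (auto simp: K_def)
  have "0 \<le> 2 * (- b / K) * b + (- b / K)\<^sup>2 * c" by (rule assms)
  also have "\<dots> \<le> 2 * (- b / K) * b + (- b / K)\<^sup>2 * K"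
    using K by (intro add_left_mono mult_left_mono) auto
  also have "\<dots> = - (b\<^sup>2 / K)"
    using K by (simp add: power2_eq_square field_simps)
  also have "\<dots> < 0" using K \<open>b \<noteq> 0\<close> by simp
  finally show False by simp
qed

locale symmetric_kernel =
  fixes V :: "'a set" and a :: "'a \<Rightarrow> 'a \<Rightarrow> real"
  assumes finite_V: "finite V"
    and a_sym: "a i j = a j i"
begin

definition ip :: "('a \<Rightarrow> real) \<Rightarrow> ('a \<Rightarrow> real) \<Rightarrow> real" where
  "ip x y = (\<Sum>i\<in>V. x i * y i)"

text \<open>Vectors indexed by \<open>V\<close> are encoded as functions on the whole type that are
  zero off \<open>V\<close>, so that equality of functions is equality of vectors.\<close>

definition vanishing :: "('a \<Rightarrow> real) \<Rightarrow> bool" where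
  "vanishing x \<longleftrightarrow> (\<forall>i. i \<notin> V \<longrightarrow> x i = 0)"

text \<open>This is the operator A - cI; the value 0 off \<open>V\<close> keeps its image inside the
  space of vanishing functions.\<close>

definition shifted :: "real \<Rightarrow> ('a \<Rightarrow> real) \<Rightarrow> 'a \<Rightarrow> real" where
  "shifted c x = (\<lambda>i. if i \<in> V then (\<Sum>j\<in>V. a i j * x j) - c * x i else 0)"

lemma ip_lincomb_left: "ip (\<lambda>i. x i + c * y i) z = ip x z + c * ip y z"
  by (simp add: ip_def algebra_simps sum.distrib sum_distrib_left)

lemma ip_lincomb_right: "ip z (\<lambda>i. x i + c * y i) = ip z x + c * ip z y"
  by (simp add: ip_def algebra_simps sum.distrib sum_distrib_left)

lemma ip_self_nonneg: "0 \<le> ip x x"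
  by (auto simp: ip_def intro: sum_nonneg)

lemma ip_self_eq_0: "ip x x = 0 \<Longrightarrow> i \<in> V \<Longrightarrow> x i = 0"
  using finite_V by (simp add: ip_def sum_nonneg_eq_0_iff)

lemma ip_self_eq_0_fun:
  assumes "vanishing x" and "ip x x = 0"
  shows "x = (\<lambda>i. 0)"
  using assms ip_self_eq_0[of x] by (auto simp: vanishing_def fun_eq_iff)

lemma ip_zero [simp]: "ip (\<lambda>i. 0) x = 0" "ip x (\<lambda>i. 0) = 0"
  by (simp_all add: ip_def)

lemma vanishing_shifted [simp]: "vanishing (shifted c x)"
  by (simp add: vanishing_def shifted_def)

lemma vanishing_lincomb: "vanishing x \<Longrightarrow> vanishing y \<Longrightarrow> vanishing (\<lambda>i. x i + c * y i)"
  by (simp add: vanishing_def)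

lemma shifted_lincomb:
  "shifted d (\<lambda>i. x i + c * y i) = (\<lambda>i. shifted d x i + c * shifted d y i)"
  by (auto simp: shifted_def fun_eq_iff algebra_simps sum.distrib sum_distrib_left)

lemma shifted_zero [simp]: "shifted d (\<lambda>i. 0) = (\<lambda>i. 0)"
  by (simp add: shifted_def fun_eq_iff)

lemma shifted_scale: "shifted d (\<lambda>i. c * y i) = (\<lambda>i. c * shifted d y i)"
  using shifted_lincomb[of d "\<lambda>i. 0" c y] by simp

lemma shifted_shift:
  assumes "vanishing x"
  shows "shifted c x = (\<lambda>i. shifted d x i + (d - c) * x i)"
  using assms by (auto simp: shifted_def fun_eq_iff algebra_simps vanishing_def)

lemma ip_shifted: "ip (shifted c x) y = ip x (shifted c y)"
proof -
  have "(\<Sum>i\<in>V. (\<Sum>j\<in>V. a i j * x j) * y i) = (\<Sum>i\<in>V. \<Sum>j\<in>V. a i j * x j * y i)"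
    by (simp add: sum_distrib_right)
  also have "\<dots> = (\<Sum>j\<in>V. \<Sum>i\<in>V. a i j * x j * y i)" by (rule sum.swap)
  also have "\<dots> = (\<Sum>j\<in>V. x j * (\<Sum>i\<in>V. a j i * y i))"
    by (simp add: sum_distrib_left mult_ac a_sym)
  finally show ?thesis
    by (simp add: ip_def shifted_def algebra_simps sum_subtractf)
qed

lemma shifted_commute: 
  assumes "vanishing x"
  shows "shifted c (shifted d x) = shifted d (shifted c x)"
proof -
  have "shifted c (shifted d x) = (\<lambda>i. shifted d (shifted d x) i + (d - c) * shifted d x i)"
    by (rule shifted_shift) simp
  also have "\<dots> = shifted d (\<lambda>i. shifted d x i + (d - c) * x i)"
    by (rule shifted_lincomb[symmetric])
  finally show ?thesis using shifted_shift[OF assms, of c d] by simp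
qed

section \<open>Rayleigh quotients and eigenvectors\<close>

lemma continuous_on_coordinate [continuous_intros]: "continuous_on S (\<lambda>x. x (i::'b) :: real)"
  by (rule continuous_on_subset[OF continuous_on_product_coordinates]) auto

text \<open>At a maximum of the Rayleigh quotient the first variation in the direction of the residual
  vanishes.\<close>

lemma rayleigh_maximizer_eigenvector:
  assumes vanish: "\<And>x. x \<in> W \<Longrightarrow> vanishing x"
    and lincomb: "\<And>x y c. x \<in> W \<Longrightarrow> y \<in> W \<Longrightarrow> (\<lambda>i. x i + c * y i) \<in> W"
    and inv: "\<And>x. x \<in> W \<Longrightarrow> shifted 0 x \<in> W"
    and bound: "\<And>x. x \<in> W \<Longrightarrow> ip (shifted 0 x) x \<le> l * ip x x"
    and vW: "v \<in> W" and eq: "ip (shifted 0 v) v = l * ip v v"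
  shows "shifted l v = (\<lambda>i. 0)"
proof -
  have shift: "ip (shifted l x) x = ip (shifted 0 x) x - l * ip x x" if "x \<in> W" for x
    unfolding shifted_shift[OF vanish[OF that], of l 0] ip_lincomb_left by simp
  define h where "h = shifted l v"
  have hW: "h \<in> W"
    unfolding h_def shifted_shift[OF vanish[OF vW], of l 0]
    by (intro lincomb inv vW)
  have "0 \<le> 2 * e * (- ip h h) + e\<^sup>2 * (- ip (shifted l h) h)" for e
  proof -
    let ?x = "\<lambda>i. v i + e * h i"
    have xW: "?x \<in> W" by (intro lincomb vW hW)
    have "ip (shifted l ?x) ?x \<le> 0" using shift[OF xW] bound[OF xW] by simp
    moreover have "ip (shifted l ?x) ?x
        = ip (shifted l v) v + 2 * e * ip h h + e\<^sup>2 * ip (shifted l h) h"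
      unfolding shifted_lincomb ip_lincomb_left ip_lincomb_right ip_shifted[of l h v] h_def[symmetric]
      by (simp add: algebra_simps power2_eq_square)
    moreover have "ip (shifted l v) v = 0" using shift[OF vW] eq by simp
    ultimately show ?thesis by simp
  qed
  then have "- ip h h = 0" by (rule nonneg_quadratic_linear_coeff)
  then show ?thesis using ip_self_eq_0_fun[OF vanish[OF hW]] by (simp add: h_def)
qed

text \<open>The unit sphere of \<open>W\<close> is compact, so the quadratic form attains a maximum
  on it, and a maximiser is an eigenvector. A general invariant subspace is allowed because the
  whole space and an orthogonal complement both serve as \<open>W\<close> later.\<close>

lemma rayleigh_maximum:
  assumes closed: "closed W"
    and vanish: "\<And>x. x \<in> W \<Longrightarrow> vanishing x"
    and lincomb: "\<And>x y c. x \<in> W \<Longrightarrow> y \<in> W \<Longrightarrow> (\<lambda>i. x i + c * y i) \<in> W"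
    and inv: "\<And>x. x \<in> W \<Longrightarrow> shifted 0 x \<in> W"
    and w: "w \<in> W" "w \<noteq> (\<lambda>i. 0)"
  obtains v l where "v \<in> W" "v \<noteq> (\<lambda>i. 0)" "shifted l v = (\<lambda>i. 0)"
    "\<And>x. x \<in> W \<Longrightarrow> ip (shifted 0 x) x \<le> l * ip x x"
proof -
  define K where "K = {x \<in> W. ip x x = 1}"
  \<comment> \<open>The unit sphere of \<open>W\<close> is a closed subset of this product of
    compact sets, which is compact in the product topology by Tychonoff's theorem.\<close>
  define box where "box = PiE UNIV (\<lambda>i. if i \<in> V then {-1..1} else {0::real})"
  have compact_box: "compact box"
  proof -
    have "compactin (product_topology (\<lambda>i. euclidean) UNIV) box"
      unfolding box_def compactin_PiE by auto
    then show ?thesis by (simp add: euclidean_product_topology)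
  qed
  have le1: "\<bar>x i\<bar> \<le> 1" if "ip x x = 1" "i \<in> V" for x i
  proof -
    have "x i * x i \<le> ip x x"
      unfolding ip_def using finite_V that by (intro member_le_sum) auto
    then show ?thesis using that by (simp add: abs_square_le_1[symmetric] power2_eq_square)
  qed
  have K_box: "K = box \<inter> (W \<inter> {x. ip x x = 1})"
  proof -
    have "x \<in> box" if "x \<in> W" "ip x x = 1" for x
      using vanish[OF that(1)] le1[OF that(2)]
      by (fastforce simp: box_def vanishing_def PiE_def extensional_def abs_le_iff)
    then show ?thesis by (auto simp: K_def)
  qed
  have cont_ip: "continuous_on UNIV (\<lambda>x. ip x x)"
    unfolding ip_def by (intro continuous_intros)
  have "compact K"
    unfolding K_box
    by (intro compact_Int_closed compact_box closed_Int closed closed_Collect_eq cont_ip continuous_on_const)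
  moreover
  \<comment> \<open>The summand 0 gives the scaled vector the shape of a linear combination, as
    required by \<open>ip_lincomb_left\<close> and \<open>shifted_lincomb\<close>.\<close>
  have normalise: "(\<lambda>i. 0 + (1 / sqrt (ip x x)) * x i) \<in> K" if "x \<in> W" "ip x x \<noteq> 0" for x
  proof -
    have "(\<lambda>i. x i + (-1) * x i) \<in> W" using lincomb[OF that(1) that(1)] .
    then have z: "(\<lambda>i. 0) \<in> W" by simp
    have "ip x x > 0" using that ip_self_nonneg[of x] by simp
    then have "ip (\<lambda>i. 0 + (1 / sqrt (ip x x)) * x i) (\<lambda>i. 0 + (1 / sqrt (ip x x)) * x i) = 1"
      unfolding ip_lincomb_left ip_lincomb_right by (simp add: field_simps)
    then show ?thesis using lincomb[OF z that(1), of "1 / sqrt (ip x x)"] by (simp add: K_def)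
  qed
  have "ip w w \<noteq> 0" using ip_self_eq_0_fun[OF vanish[OF w(1)]] w(2) by blast
  then have "K \<noteq> {}" using normalise[OF w(1)] by blast
  moreover have "continuous_on K (\<lambda>x. ip (shifted 0 x) x)"
  proof -
    have "(\<lambda>x. ip (shifted 0 x) x) = (\<lambda>x. \<Sum>i\<in>V. (\<Sum>j\<in>V. a i j * x j) * x i)"
      by (simp add: ip_def shifted_def)
    then show ?thesis by (simp only:) (intro continuous_intros)
  qed
  ultimately obtain v where v: "v \<in> K" "\<And>y. y \<in> K \<Longrightarrow> ip (shifted 0 y) y \<le> ip (shifted 0 v) v"
    using continuous_attains_sup[of K "\<lambda>x. ip (shifted 0 x) x"] by blast
  define l where "l = ip (shifted 0 v) v"
  have vW: "v \<in> W" and v1: "ip v v = 1" using v(1) by (auto simp: K_def)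
  have bound: "ip (shifted 0 x) x \<le> l * ip x x" if "x \<in> W" for x
  proof (cases "ip x x = 0")
    case True
    then show ?thesis using ip_self_eq_0_fun[OF vanish[OF that] True] by simp
  next
    case False
    then have pos: "ip x x > 0" using ip_self_nonneg[of x] by simp
    have "ip (shifted 0 (\<lambda>i. 0 + (1 / sqrt (ip x x)) * x i)) (\<lambda>i. 0 + (1 / sqrt (ip x x)) * x i) \<le> l"
      using v(2)[OF normalise[OF that False]] unfolding l_def .
    then have "1 / sqrt (ip x x) * (1 / sqrt (ip x x) * ip (shifted 0 x) x) \<le> l"
      unfolding shifted_lincomb ip_lincomb_left ip_lincomb_right by simp
    then show ?thesis using pos by (simp add: field_simps)
  qed
  have "shifted l v = (\<lambda>i. 0)"
    by (rule rayleigh_maximizer_eigenvector[of W, OF vanish lincomb inv bound vW])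
      (simp_all add: l_def v1)
  moreover have "v \<noteq> (\<lambda>i. 0)" using v1 by auto
  ultimately show thesis using that vW bound by blast
qed

lemma closed_vanishing: "closed {x. vanishing x}"
  unfolding vanishing_def
  by (intro closed_Collect_all closed_Collect_imp open_Collect_const closed_Collect_eq continuous_intros)

text \<open>A symmetric operator is diagonalisable, so its eigenvalues are simple roots of its
  minimal polynomial. In place of an eigenbasis, the proof looks for an eigenvector orthogonal to
  the kernel of the product.\<close>

lemma annihilated:
  assumes eig: "\<And>v l. vanishing v \<Longrightarrow> v \<noteq> (\<lambda>i. 0) \<Longrightarrow> shifted l v = (\<lambda>i. 0) \<Longrightarrow> l \<in> {s, p, q}"
    and x: "vanishing x"
  shows "shifted s (shifted p (shifted q x)) = (\<lambda>i. 0)"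
proof (rule ccontr)
  define B where "B = (\<lambda>x. shifted s (shifted p (shifted q x)))"
  assume "\<not> ?thesis"
  then have Bx: "B x \<noteq> (\<lambda>i. 0)" by (simp add: B_def)
  have B_perm: "shifted q (shifted p (shifted s u)) = B u"
    "shifted p (shifted q (shifted s u)) = B u" if "vanishing u" for u
    unfolding B_def using that by (simp_all add: shifted_commute[of _ s] shifted_commute[of _ p q])
  \<comment> \<open>\<open>W\<close>, the orthogonal complement of the kernel of \<open>B\<close>, is invariant and contains no
    eigenvector of eigenvalue \<open>s\<close>, \<open>p\<close> or \<open>q\<close>, so it must be zero.\<close>
  define W where "W = {y. vanishing y \<and> (\<forall>u. vanishing u \<and> B u = (\<lambda>i. 0) \<longrightarrow> ip u y = 0)}"
  have "closed W"
  proof -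
    have "closed {y. \<forall>u. vanishing u \<and> B u = (\<lambda>i. 0) \<longrightarrow> ip u y = 0}"
      unfolding ip_def
      by (intro closed_Collect_all closed_Collect_imp open_Collect_const closed_Collect_eq continuous_intros)
    moreover note closed_vanishing
    ultimately show ?thesis unfolding W_def by (simp add: closed_Collect_conj)
  qed
  moreover have "vanishing y" if "y \<in> W" for y using that by (simp add: W_def)
  moreover have "(\<lambda>i. y i + c * z i) \<in> W" if "y \<in> W" "z \<in> W" for y z c
    using that by (auto simp: W_def vanishing_lincomb ip_lincomb_right)
  moreover have "shifted 0 y \<in> W" if "y \<in> W" for y
  proof -
    have "B (shifted 0 u) = shifted 0 (B u)" if "vanishing u" for u
      using that by (simp add: B_def shifted_commute[of _ 0])
    then show ?thesis using that by (auto simp: W_def ip_shifted[symmetric])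
  qed
  \<comment> \<open>\<open>B\<close> is a product of commuting self-adjoint factors, hence
    self-adjoint, and its range is orthogonal to its kernel.\<close>
  moreover have "B x \<in> W"
  proof -
    have "ip u (B x) = ip (B u) x" if "vanishing u" for u
      using B_perm[OF that] by (simp add: ip_shifted[symmetric] B_def)
    then show ?thesis by (auto simp: W_def B_def)
  qed
  ultimately obtain v l where v: "v \<in> W" "v \<noteq> (\<lambda>i. 0)" "shifted l v = (\<lambda>i. 0)"
    using Bx by (rule rayleigh_maximum) auto
  then have vv: "vanishing v" by (simp add: W_def)
  have "l = s \<or> l = p \<or> l = q" using eig[OF vv v(2,3)] by simp
  \<comment> \<open>Whichever eigenvalue \<open>l\<close> is, the factor that kills \<open>v\<close>
    can be applied first.\<close>
  moreover have "B v = shifted q (shifted p (shifted s v))" "B v = shifted s (shifted q (shifted p v))"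
    "B v = shifted s (shifted p (shifted q v))"
    using B_perm(1)[OF vv] shifted_commute[OF vv, of p q] by (simp_all add: B_def)
  ultimately have "B v = (\<lambda>i. 0)" using v(3) by (elim disjE) (simp_all only: shifted_zero)
  then have "ip v v = 0" using v(1) vv by (simp add: W_def)
  then show False using ip_self_eq_0_fun[OF vv] v(2) by simp
qed

text \<open>The maximum of the Rayleigh quotient on the whole space is itself an eigenvalue.\<close>

lemma rayleigh_bound:
  assumes eig: "\<And>v l. vanishing v \<Longrightarrow> v \<noteq> (\<lambda>i. 0) \<Longrightarrow> shifted l v = (\<lambda>i. 0) \<Longrightarrow> l \<le> s"
    and x: "vanishing x"
  shows "ip (shifted 0 x) x \<le> s * ip x x"
proof (cases "x = (\<lambda>i. 0)")
  case False
  obtain v l where v: "v \<in> {y. vanishing y}" "v \<noteq> (\<lambda>i. 0)" "shifted l v = (\<lambda>i. 0)"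
    "\<And>x. x \<in> {y. vanishing y} \<Longrightarrow> ip (shifted 0 x) x \<le> l * ip x x"
  proof (rule rayleigh_maximum[OF closed_vanishing])
    show "x \<in> {y. vanishing y}" "x \<noteq> (\<lambda>i. 0)" using x False by simp_all
  qed (simp_all add: vanishing_lincomb)
  have "l * ip x x \<le> s * ip x x"
    using eig[OF _ v(2,3)] v(1) by (intro mult_right_mono ip_self_nonneg) simp
  then show ?thesis using v(4)[of x] x by simp
qed simp

end

section \<open>Perron-Frobenius theory for irreducible kernels\<close>

locale irreducible_kernel = symmetric_kernel +
  assumes nonneg: "0 \<le> a i j"
    and irreducible: "\<And>S. S \<subseteq> V \<Longrightarrow> S \<noteq> {} \<Longrightarrow> (\<And>i j. i \<in> S \<Longrightarrow> j \<in> V \<Longrightarrow> a i j \<noteq> 0 \<Longrightarrow> j \<in> S) \<Longrightarrow> S = V"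
begin

text \<open>At a zero of \<open>x\<close> the eigenvector equation makes a sum of nonnegative terms
  vanish, so the zero set is closed under neighbours and irreducibility applies to it.\<close>

lemma nonneg_eigenvector_pos:
  assumes x: "vanishing x" "\<And>i. 0 \<le> x i" "x \<noteq> (\<lambda>i. 0)" and ev: "shifted s x = (\<lambda>i. 0)"
    and i: "i \<in> V"
  shows "0 < x i"
proof (rule ccontr)
  assume "\<not> 0 < x i"
  define S where "S = {i \<in> V. x i = 0}"
  have "S = V"
  proof (rule irreducible)
    show "S \<noteq> {}" using \<open>\<not> 0 < x i\<close> x(2)[of i] i by (auto simp: S_def)
    fix i j assume ij: "i \<in> S" "j \<in> V" "a i j \<noteq> 0"
    have "(\<Sum>j\<in>V. a i j * x j) = 0"
      using fun_cong[OF ev, of i] ij(1) by (simp add: shifted_def S_def)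
    then show "j \<in> S"
      using ij finite_V nonneg x(2) by (auto simp: sum_nonneg_eq_0_iff S_def)
  qed (simp add: S_def)
  then have "x = (\<lambda>i. 0)" using x(1) by (auto simp: S_def vanishing_def fun_eq_iff)
  then show False using x(3) by simp
qed

text \<open>Passing to absolute values keeps the norm and does not decrease the quadratic form,
  since the entries of \<open>a\<close> are nonnegative. So |z| attains the upper bound too.\<close>

lemma top_eigenvector_abs:
  assumes bound: "\<And>x. vanishing x \<Longrightarrow> ip (shifted 0 x) x \<le> s * ip x x"
    and z: "vanishing z" and ev: "shifted s z = (\<lambda>i. 0)"
  shows "shifted s (\<lambda>i. \<bar>z i\<bar>) = (\<lambda>i. 0)"
proof (rule rayleigh_maximizer_eigenvector[of "{y. vanishing y}"])
  let ?z = "\<lambda>i. \<bar>z i\<bar>"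
  show z': "?z \<in> {y. vanishing y}" using z by (simp add: vanishing_def)
  have "ip (shifted s z) z = ip (shifted 0 z) z - s * ip z z"
    unfolding shifted_shift[OF z, of s 0] ip_lincomb_left by simp
  then have "s * ip z z = ip (shifted 0 z) z" using ev by simp
  also have "\<dots> \<le> ip (shifted 0 ?z) ?z"
  proof -
    have "(\<Sum>j\<in>V. a i j * z j) * z i \<le> (\<Sum>j\<in>V. a i j * \<bar>z j\<bar>) * \<bar>z i\<bar>" for i
    proof -
      have "a i j * z j * z i \<le> a i j * \<bar>z j\<bar> * \<bar>z i\<bar>" for j
        using mult_left_mono[OF abs_ge_self[of "z j * z i"] nonneg[of i j]] 
        by (simp add: abs_mult mult.assoc)
      then show ?thesis by (simp add: sum_distrib_right sum_mono)
    qed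
    then show ?thesis by (simp add: ip_def shifted_def sum_mono)
  qed
  finally have "s * ip ?z ?z \<le> ip (shifted 0 ?z) ?z" by (simp add: ip_def)
  moreover have "ip (shifted 0 ?z) ?z \<le> s * ip ?z ?z" using bound z' by simp
  ultimately show "ip (shifted 0 ?z) ?z = s * ip ?z ?z" by simp
qed (auto simp: vanishing_lincomb bound)

text \<open>Subtracting a suitable multiple of \<open>y\<close> produces a top eigenvector with a
  zero entry. Its absolute value is not positive everywhere, so it must be the zero vector.\<close>

lemma top_eigenspace_dim_one:
  assumes bound: "\<And>x. vanishing x \<Longrightarrow> ip (shifted 0 x) x \<le> s * ip x x"
    and x: "vanishing x" "shifted s x = (\<lambda>i. 0)"
    and y: "vanishing y" "shifted s y = (\<lambda>i. 0)" "\<And>i. i \<in> V \<Longrightarrow> 0 < y i"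
  obtains c where "x = (\<lambda>i. c * y i)"
proof (cases "V = {}")
  case True
  then have "x = (\<lambda>i. 0 * y i)" using x(1) unfolding vanishing_def by auto
  then show ?thesis by (rule that)
next
  case False
  then obtain k where k: "k \<in> V" by blast
  define c where "c = x k / y k"
  define w where "w = (\<lambda>i. x i + (- c) * y i)"
  have w: "vanishing w" "shifted s w = (\<lambda>i. 0)"
    unfolding w_def by (simp_all only: vanishing_lincomb x y shifted_lincomb) simp
  have "w k = 0" using y(3)[OF k] by (simp add: w_def c_def)
  have "w = (\<lambda>i. 0)"
  proof (rule ccontr)
    assume "w \<noteq> (\<lambda>i. 0)"
    then have "(\<lambda>i. \<bar>w i\<bar>) \<noteq> (\<lambda>i. 0)" by (auto simp: fun_eq_iff)
    then have "0 < \<bar>w k\<bar>"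
      using w top_eigenvector_abs[OF bound w] k
      by (intro nonneg_eigenvector_pos[of "\<lambda>i. \<bar>w i\<bar>" s]) (auto simp: vanishing_def)
    then show False using \<open>w k = 0\<close> by simp
  qed
  then have "x = (\<lambda>i. c * y i)" by (simp add: w_def fun_eq_iff)
  then show ?thesis by (rule that)
qed

text \<open>By \<open>annihilated\<close>, (A - p)(A - q) maps into the eigenspace of
  \<open>s\<close>, a line spanned by a positive vector \<open>y\<close>. By symmetry it is a
  multiple \<open>r\<close> of the outer square of \<open>y\<close>, and \<alpha> is
  \<open>y\<close> scaled by \<open>sqrt r\<close>.\<close>

theorem three_eigenvalues_rank_one:
  assumes eig: "\<And>v l. vanishing v \<Longrightarrow> v \<noteq> (\<lambda>i. 0) \<Longrightarrow> shifted l v = (\<lambda>i. 0) \<Longrightarrow> l \<in> {s, p, q}"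
    and z: "vanishing z" "z \<noteq> (\<lambda>i. 0)" "shifted s z = (\<lambda>i. 0)"
    and less: "p < s" "q < s"
  shows "\<exists>\<alpha>. (\<forall>i\<in>V. 0 < \<alpha> i) \<and> (\<forall>i\<in>V. (\<Sum>j\<in>V. a i j * \<alpha> j) = s * \<alpha> i) \<and>
    (\<forall>i\<in>V. \<forall>j\<in>V. (\<Sum>k\<in>V. a i k * a k j) - (p + q) * a i j
      + (if i = j then p * q else 0) = \<alpha> i * \<alpha> j)"
proof -
  have "l \<le> s" if "vanishing v" "v \<noteq> (\<lambda>i. 0)" "shifted l v = (\<lambda>i. 0)" for v l
    using eig[OF that] less by auto
  then have bound: "ip (shifted 0 x) x \<le> s * ip x x" if "vanishing x" for x
    using that rayleigh_bound[of s x] by blast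
  define y where "y = (\<lambda>i. \<bar>z i\<bar>)"
  have y: "vanishing y" "shifted s y = (\<lambda>i. 0)"
    using z top_eigenvector_abs[OF bound z(1,3)] by (auto simp: y_def vanishing_def)
  have y_ne: "y \<noteq> (\<lambda>i. 0)" using z(2) by (auto simp: y_def fun_eq_iff)
  have y_pos: "0 < y i" if "i \<in> V" for i
    using nonneg_eigenvector_pos[OF y(1) _ y_ne y(2) that] by (simp add: y_def)
  \<comment> \<open>For \<open>j\<close> in \<open>V\<close> this is the standard basis vector, so
    \<open>m j\<close> below is column \<open>j\<close> of (A - p)(A - q).\<close>
  define e where "e = (\<lambda>j i. if i = j \<and> i \<in> V then 1 else 0 :: real)"
  have e: "vanishing (e j)" for j by (auto simp: e_def vanishing_def)
  have ip_e: "ip x (e j) = x j" "ip (e j) x = x j" if "j \<in> V" for x j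
    using that finite_V by (simp_all add: ip_def e_def if_distrib if_distribR cong: if_cong)
  define m where "m = (\<lambda>j. shifted p (shifted q (e j)))"
  have "\<exists>c. m j = (\<lambda>i. c * y i)" for j
  proof -
    have "shifted s (m j) = (\<lambda>i. 0)"
      using annihilated[OF eig e] by (simp add: m_def)
    then show ?thesis
      using top_eigenspace_dim_one[OF bound _ _ y y_pos, of "m j"] by (auto simp: m_def)
  qed
  then obtain c where c: "\<And>j. m j = (\<lambda>i. c j * y i)" by metis
  have m_sym: "m j i = m i j" if "i \<in> V" "j \<in> V" for i j
  proof -
    have "m j i = ip (e i) (m j)" using that by (simp add: ip_e)
    also have "\<dots> = ip (m i) (e j)"
      using shifted_commute[OF e] by (simp add: m_def ip_shifted[symmetric])
    finally show ?thesis using that by (simp add: ip_e)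
  qed
  obtain k where k: "k \<in> V" using z(1,2) by (force simp: vanishing_def fun_eq_iff)
  define r where "r = c k / y k"
  have c_eq: "c j = r * y j" if "j \<in> V" for j
    using m_sym[OF that k] c y_pos[OF k] by (simp add: r_def field_simps)
  have m_eq: "m j i = r * y i * y j" if "j \<in> V" for i j
    using c c_eq[OF that] by simp
  have shift_y: "shifted d y = (\<lambda>i. (s - d) * y i)" for d
    unfolding shifted_shift[OF y(1), of d s] y(2) by simp
  \<comment> \<open>Applying (A - p)(A - q) to \<open>y\<close> once by its rank-one form and once
    by the eigenvalue \<open>s\<close> shows that \<open>r\<close> is positive and has a square
    root.\<close>
  have "r * ip y y * y k = ip (m k) y"
    using k by (simp add: m_eq ip_def sum_distrib_left mult_ac)
  also have "\<dots> = ip (e k) (shifted q (shifted p y))"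
    by (simp add: m_def ip_shifted)
  also have "\<dots> = (s - p) * (s - q) * y k"
    using k by (simp add: ip_e shift_y shifted_scale)
  finally have "r * ip y y = (s - p) * (s - q)" using y_pos[OF k] by simp
  also have "\<dots> > 0" using less by simp
  finally have r: "r > 0"
    using ip_self_nonneg[of y] by (simp add: zero_less_mult_iff)
  define \<alpha> where "\<alpha> = (\<lambda>i. sqrt r * y i)"
  show ?thesis
  proof (intro exI[of _ \<alpha>] conjI ballI)
    show "0 < \<alpha> i" if "i \<in> V" for i using r y_pos[OF that] by (simp add: \<alpha>_def)
    show "(\<Sum>j\<in>V. a i j * \<alpha> j) = s * \<alpha> i" if "i \<in> V" for i
    proof -
      have "(\<Sum>j\<in>V. a i j * y j) = s * y i"
        using fun_cong[OF y(2), of i] that by (simp add: shifted_def)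
      then show ?thesis by (simp add: \<alpha>_def mult.left_commute[of _ "sqrt r"] sum_distrib_left[symmetric])
    qed
    show "(\<Sum>k\<in>V. a i k * a k j) - (p + q) * a i j + (if i = j then p * q else 0) = \<alpha> i * \<alpha> j"
      if "i \<in> V" "j \<in> V" for i j
    proof -
      have sum_e: "(\<Sum>k\<in>V. f k * e j k) = f j" for f
        using ip_e(1)[OF \<open>j \<in> V\<close>, of f] by (simp add: ip_def)
      have "shifted q (e j) k = a k j - q * e j k" if "k \<in> V" for k
        using that by (simp add: shifted_def sum_e)
      then have "m j i = (\<Sum>k\<in>V. a i k * (a k j - q * e j k)) - p * (a i j - q * e j i)"
        using \<open>i \<in> V\<close> by (simp add: m_def shifted_def[of p])
      also have "(\<Sum>k\<in>V. a i k * (a k j - q * e j k)) = (\<Sum>k\<in>V. a i k * a k j) - q * a i j"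
        using sum_e[of "\<lambda>k. q * a i k"] by (simp add: algebra_simps sum_subtractf)
      finally have "m j i = (\<Sum>k\<in>V. a i k * a k j) - (p + q) * a i j + (if i = j then p * q else 0)"
        using \<open>i \<in> V\<close> by (simp add: e_def algebra_simps)
      moreover have "m j i = \<alpha> i * \<alpha> j"
        using r m_eq[OF \<open>j \<in> V\<close>] by (simp add: \<alpha>_def algebra_simps)
      ultimately show ?thesis by simp
    qed
  qed
qed

end

section \<open>Graphs of rank one with a vertex of weight one\<close>

locale rank_one_graph =
  fixes V :: "'a set" and adj :: "'a \<Rightarrow> 'a \<Rightarrow> bool" and \<alpha> :: "'a \<Rightarrow> int" and s t :: int
  assumes finite_V: "finite V"
    and adj_sym: "adj u v \<longleftrightarrow> adj v u"
    and adj_irrefl: "\<not> adj u u"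
    and t_ge: "t \<ge> 7"
    and \<alpha>_pos: "u \<in> V \<Longrightarrow> 1 \<le> \<alpha> u"
    and degree: "u \<in> V \<Longrightarrow> int (card {w \<in> V. adj u w}) = t + (\<alpha> u)\<^sup>2"
    and common_adj: "u \<in> V \<Longrightarrow> v \<in> V \<Longrightarrow> adj u v \<Longrightarrow>
      int (card ({w \<in> V. adj u w} \<inter> {w \<in> V. adj v w})) = \<alpha> u * \<alpha> v + 1 - t"
    and common_nonadj: "u \<in> V \<Longrightarrow> v \<in> V \<Longrightarrow> u \<noteq> v \<Longrightarrow> \<not> adj u v \<Longrightarrow>
      int (card ({w \<in> V. adj u w} \<inter> {w \<in> V. adj v w})) = \<alpha> u * \<alpha> v"
    and eigen: "u \<in> V \<Longrightarrow> (\<Sum>w\<in>{w \<in> V. adj u w}. \<alpha> w) = s * \<alpha> u"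
begin

definition nb :: "'a \<Rightarrow> 'a set" where
  "nb u = {w \<in> V. adj u w}"

lemma finite_nb [simp]: "finite (nb u)"
  using finite_V by (simp add: nb_def)

lemma nb_subset: "nb u \<subseteq> V"
  by (auto simp: nb_def)

lemma in_nb_sym: "u \<in> V \<Longrightarrow> v \<in> nb u \<Longrightarrow> u \<in> nb v"
  using adj_sym by (simp add: nb_def)

lemma not_in_nb_self [simp]: "u \<notin> nb u"
  using adj_irrefl by (simp add: nb_def)

lemma card_nb: "u \<in> V \<Longrightarrow> int (card (nb u)) = t + (\<alpha> u)\<^sup>2"
  using degree by (simp add: nb_def)

lemma card_common_adj:
  "u \<in> V \<Longrightarrow> v \<in> nb u \<Longrightarrow> int (card (nb u \<inter> nb v)) = \<alpha> u * \<alpha> v + 1 - t"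
  using common_adj by (simp add: nb_def)

lemma card_common_nonadj:
  "u \<in> V \<Longrightarrow> v \<in> V \<Longrightarrow> u \<noteq> v \<Longrightarrow> v \<notin> nb u \<Longrightarrow> int (card (nb u \<inter> nb v)) = \<alpha> u * \<alpha> v"
  using common_nonadj by (simp add: nb_def)

lemma card_nb_Diff:
  "u \<in> V \<Longrightarrow> int (card (nb u - nb v)) = t + (\<alpha> u)\<^sup>2 - int (card (nb u \<inter> nb v))"
  using card_nb[of u] by (simp add: card_Diff_subset_Int card_mono of_nat_diff)

lemma card_nb_Diff_adj:
  assumes "u \<in> V" "v \<in> nb u"
  shows "int (card (nb u - nb v)) = 2 * t - 1 + \<alpha> u * (\<alpha> u - \<alpha> v)"
  using card_nb_Diff[OF assms(1), of v] card_common_adj[OF assms]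
  by (simp add: algebra_simps power2_eq_square)

text \<open>Such differences are the main source of inequalities: the count is nonnegative, which
  bounds how far \<alpha> may rise from \<open>u\<close> to \<open>v\<close>.\<close>

lemma card_nb_Diff_nonadj:
  assumes "u \<in> V" "v \<in> V" "u \<noteq> v" "v \<notin> nb u"
  shows "int (card (nb u - nb v)) = t + \<alpha> u * (\<alpha> u - \<alpha> v)"
  using card_nb_Diff[OF assms(1), of v] card_common_nonadj[OF assms]
  by (simp add: algebra_simps power2_eq_square)

lemma sum_nb: "u \<in> V \<Longrightarrow> (\<Sum>w\<in>nb u. \<alpha> w) = s * \<alpha> u"
  using eigen by (simp add: nb_def)

text \<open>The weight \<open>t + 1 - \<alpha> w\<close> ignores vertices of value
  \<open>t + 1\<close> and is \<open>t\<close> at those of value 1.\<close>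

lemma sum_deficit:
  assumes "u \<in> V"
  shows "(\<Sum>w\<in>nb u. t + 1 - \<alpha> w) = (t + 1) * (t + (\<alpha> u)\<^sup>2) - s * \<alpha> u"
  using sum_nb[OF assms] card_nb[OF assms] by (simp add: sum_subtractf mult.commute)

end

section \<open>The neighbourhood of a vertex of weight one\<close>

locale rank_one_graph_small = rank_one_graph +
  fixes x :: 'a
  assumes x_in_V: "x \<in> V" and \<alpha>_x: "\<alpha> x = 1"
begin

definition N :: "'a set" where "N = nb x"
definition Z :: "'a set" where "Z = V - N - {x}"

lemma N_subset: "N \<subseteq> V"
  by (simp add: N_def nb_subset)

lemma in_N_V: "y \<in> N \<Longrightarrow> y \<in> V"
  using N_subset by blast

lemma in_Z_V: "z \<in> Z \<Longrightarrow> z \<in> V"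
  by (simp add: Z_def)

lemma finite_N [simp]: "finite N"
  by (simp add: N_def)

lemma finite_Z [simp]: "finite Z"
  using finite_V by (simp add: Z_def)

lemma x_in_nb: "y \<in> N \<Longrightarrow> x \<in> nb y"
  using in_nb_sym x_in_V by (simp add: N_def)

lemma x_notin_N [simp]: "x \<notin> N"
  by (simp add: N_def)

lemma x_notin_nb_Z: "z \<in> Z \<Longrightarrow> x \<notin> nb z"
  using in_nb_sym by (auto simp: Z_def N_def)

lemma N_Z_disjoint: "N \<inter> Z = {}"
  by (auto simp: Z_def)

lemma V_eq: "V = insert x (N \<union> Z)"
  using N_subset x_in_V by (auto simp: Z_def)

lemma V_cases:
  assumes "v \<in> V"
  obtains "v = x" | "v \<in> N" | "v \<in> Z"
  using assms V_eq by blast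

lemma card_N: "int (card N) = t + 1"
  using card_nb[OF x_in_V] \<alpha>_x by (simp add: N_def)

lemma sum_N: "(\<Sum>y\<in>N. \<alpha> y) = s"
  using sum_nb[OF x_in_V] \<alpha>_x by (simp add: N_def)

text \<open>Because \<open>\<alpha> x = 1\<close>, common neighbours with \<open>x\<close> measure
  \<open>\<alpha> y\<close> itself. This and \<open>card_nb_Z\<close> turn values of \<alpha> into
  numbers of neighbours in \<open>N\<close>.\<close>

lemma card_nb_N: "y \<in> N \<Longrightarrow> int (card (nb y \<inter> N)) = \<alpha> y + 1 - t"
  using card_common_adj[OF x_in_V, of y] \<alpha>_x by (simp add: N_def Int_commute)

lemma N_ge: "y \<in> N \<Longrightarrow> t - 1 \<le> \<alpha> y"
  using card_nb_N[of y] by linarith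

lemma card_nb_Z: "z \<in> Z \<Longrightarrow> int (card (nb z \<inter> N)) = \<alpha> z"
  using card_common_nonadj[OF x_in_V, of z] \<alpha>_x by (auto simp: N_def Z_def Int_commute)

lemma Z_le: "z \<in> Z \<Longrightarrow> \<alpha> z \<le> t + 1"
  using card_nb_Z[of z] card_N card_mono[of N "nb z \<inter> N"] by simp

lemma Z_full:
  assumes "z \<in> Z" "\<alpha> z = t + 1"
  shows "N \<subseteq> nb z"
proof -
  have "nb z \<inter> N = N"
    using card_nb_Z[OF assms(1)] card_N assms(2) by (intro card_subset_eq) auto
  then show ?thesis by blast
qed

text \<open>With a gap of at least 2, the size of \<open>nb y - nb y'\<close> would be negative in
  the nonadjacent case. In the adjacent case it is at most \<open>2 * t - 1 - 2 * \<alpha> y\<close>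
  but contains \<open>y'\<close>, so \<open>\<alpha> y \<le> t - 1\<close>; yet having the neighbour
  \<open>y'\<close> in \<open>N\<close> requires \<open>\<alpha> y \<ge> t\<close>.\<close>

lemma N_diff_le_1:
  assumes y: "y \<in> N" "y' \<in> N"
  shows "\<alpha> y' \<le> \<alpha> y + 1"
proof (rule ccontr)
  assume "\<not> ?thesis"
  then have gt: "\<alpha> y' - \<alpha> y \<ge> 2" by simp
  have "2 * \<alpha> y \<le> \<alpha> y * (\<alpha> y' - \<alpha> y)"
    using mult_left_mono[OF gt, of "\<alpha> y"] N_ge[OF y(1)] t_ge by simp
  then have le: "\<alpha> y * (\<alpha> y - \<alpha> y') \<le> - 2 * \<alpha> y" by (simp add: algebra_simps)
  have ne: "y \<noteq> y'" using gt by auto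
  show False
  proof (cases "y' \<in> nb y")
    case True
    have "{y'} \<subseteq> nb y - nb y'" using True by simp
    then have "card {y'} \<le> card (nb y - nb y')" by (intro card_mono) auto
    moreover have "card {y'} \<le> card (nb y \<inter> N)" using True y by (intro card_mono) auto
    ultimately show False
      using card_nb_Diff_adj[OF in_N_V[OF y(1)] True] card_nb_N[OF y(1)] le by simp
  next
    case False
    then show False
      using card_nb_Diff_nonadj[OF in_N_V[OF y(1)] in_N_V[OF y(2)] ne] le N_ge[OF y(1)] t_ge
      by linarith
  qed
qed

text \<open>Of the \<open>\<alpha> z\<close> neighbours of \<open>z\<close> in \<open>N\<close>, at
  most \<open>\<alpha> y + 1 - t\<close> are neighbours of \<open>y\<close>, and the rest lie in
  \<open>nb z - nb y\<close>. If \<open>\<alpha> y\<close> were larger, this would force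
  \<open>\<alpha> z = 2\<close> and \<open>\<alpha> y = 3\<close>, below the bound
  \<open>t - 1\<close>.\<close>

lemma nonadj_N_Z_ge:
  assumes y: "y \<in> N" and z: "z \<in> Z" "z \<notin> nb y" "\<alpha> z \<noteq> 1"
  shows "\<alpha> y \<le> \<alpha> z"
proof (rule ccontr)
  assume "\<not> ?thesis"
  then have gt: "\<alpha> y - \<alpha> z \<ge> 1" by simp
  have yz: "y \<notin> nb z" "y \<noteq> z" using z y in_nb_sym[OF in_Z_V[OF z(1)]] by (auto simp: Z_def)
  have z2: "\<alpha> z \<ge> 2" using \<alpha>_pos[OF in_Z_V[OF z(1)]] z(3) by simp
  have "nb z \<inter> N - nb y \<inter> N \<subseteq> nb z - nb y" by blast
  then have "card (nb z \<inter> N) - card (nb y \<inter> N) \<le> card (nb z - nb y)"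
    by (intro order_trans[OF diff_card_le_card_Diff] card_mono) auto
  then have "int (card (nb z \<inter> N)) - int (card (nb y \<inter> N)) \<le> int (card (nb z - nb y))"
    by linarith
  then have "\<alpha> z - (\<alpha> y + 1 - t) \<le> t + \<alpha> z * (\<alpha> z - \<alpha> y)"
    using card_nb_Z[OF z(1)] card_nb_N[OF y] 
      card_nb_Diff_nonadj[OF in_Z_V[OF z(1)] in_N_V[OF y] yz(2)[symmetric] yz(1)] by simp
  then have le: "(\<alpha> z - 1) * (\<alpha> y - \<alpha> z) \<le> 1" by (simp add: algebra_simps)
  have "\<alpha> y - \<alpha> z \<le> 1"
    using order_trans[OF mult_right_mono[of 1 "\<alpha> z - 1" "\<alpha> y - \<alpha> z"] le] z2 gt by simp
  moreover have "\<alpha> z - 1 \<le> 1"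
    using order_trans[OF mult_left_mono[of 1 "\<alpha> y - \<alpha> z" "\<alpha> z - 1"] le] z2 gt by simp
  ultimately show False using N_ge[OF y] t_ge by simp
qed

text \<open>The vertex \<open>x\<close> lies in \<open>nb y - nb z\<close>, hence
  \<open>\<alpha> y * (\<alpha> z - \<alpha> y) \<le> t - 1\<close>. As
  \<open>\<alpha> y \<ge> t - 1\<close>, the gap is at most 1, and a gap of 1 needs
  \<open>\<alpha> y = t - 1\<close>.\<close>

lemma nonadj_N_Z:
  assumes y: "y \<in> N" and z: "z \<in> Z" "z \<notin> nb y" "\<alpha> z \<noteq> 1"
  shows "\<alpha> z = \<alpha> y \<or> \<alpha> y = t - 1 \<and> \<alpha> z = t"
proof -
  have ge: "\<alpha> y \<le> \<alpha> z" by (rule nonadj_N_Z_ge[OF assms])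
  have yz: "y \<noteq> z" using y z(1) N_Z_disjoint by blast
  have "{x} \<subseteq> nb y - nb z" using x_in_nb[OF y] x_notin_nb_Z[OF z(1)] by simp
  then have "card {x} \<le> card (nb y - nb z)" by (intro card_mono) auto
  then have le: "\<alpha> y * (\<alpha> z - \<alpha> y) \<le> t - 1"
    using card_nb_Diff_nonadj[OF in_N_V[OF y] in_Z_V[OF z(1)] yz z(2)]
    by (simp add: algebra_simps)
  have "\<alpha> z - \<alpha> y < 2"
  proof (rule ccontr)
    assume "\<not> ?thesis"
    then have "\<alpha> y * 2 \<le> \<alpha> y * (\<alpha> z - \<alpha> y)"
      using N_ge[OF y] t_ge by (intro mult_left_mono) auto
    then show False using le N_ge[OF y] t_ge by linarith
  qed
  then consider "\<alpha> z = \<alpha> y" | "\<alpha> z = \<alpha> y + 1" using ge by linarith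
  then show ?thesis
  proof cases
    case 2
    then show ?thesis using le N_ge[OF y] by simp
  qed simp
qed

text \<open>There are \<open>\<alpha> y\<close> common neighbours, but \<open>z\<close> has only
  \<open>t + 1\<close> neighbours.\<close>

lemma nonadj_N_small_le:
  assumes y: "y \<in> N" and z: "z \<in> Z" "z \<notin> nb y" "\<alpha> z = 1"
  shows "\<alpha> y \<le> t + 1"
proof -
  have "y \<noteq> z" using y z(1) N_Z_disjoint by blast
  then have "int (card (nb y \<inter> nb z)) = \<alpha> y"
    using card_common_nonadj[OF in_N_V[OF y] in_Z_V[OF z(1)] _ z(2)] z(3) by simp
  moreover have "card (nb y \<inter> nb z) \<le> card (nb z)" by (intro card_mono) auto
  ultimately show ?thesis using card_nb[OF in_Z_V[OF z(1)]] z(3) by simp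
qed

lemma Z_nonadj_exists:
  assumes "z \<in> Z" "\<alpha> z \<noteq> t + 1"
  obtains y where "y \<in> N" "z \<notin> nb y"
proof -
  have "\<not> N \<subseteq> nb z"
  proof
    assume "N \<subseteq> nb z"
    then have "nb z \<inter> N = N" by blast
    then show False using card_nb_Z[OF assms(1)] card_N assms(2) by simp
  qed
  then obtain y where "y \<in> N" "y \<notin> nb z" by blast
  moreover have "z \<notin> nb y" using in_nb_sym[OF in_N_V] \<open>y \<in> N\<close> \<open>y \<notin> nb z\<close> by blast
  ultimately show ?thesis using that by blast
qed

lemma Z_values:
  assumes z: "z \<in> Z"
  shows "\<alpha> z = 1 \<or> \<alpha> z = t + 1 \<or> \<alpha> z \<in> \<alpha> ` N \<or> \<alpha> z = t \<and> t - 1 \<in> \<alpha> ` N"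
proof (cases "\<alpha> z = 1 \<or> \<alpha> z = t + 1")
  case False
  then obtain y where y: "y \<in> N" "z \<notin> nb y" using Z_nonadj_exists[OF z] by blast
  show ?thesis using nonadj_N_Z[OF y(1) z y(2)] False y(1) by force
qed auto

lemma nb_split:
  assumes "y \<in> N"
  shows "nb y = insert x (nb y \<inter> N \<union> nb y \<inter> Z)"
  using nb_subset[of y] x_in_nb[OF assms] V_eq by blast

lemma sum_nb_split:
  fixes f :: "'a \<Rightarrow> int"
  assumes "y \<in> N"
  shows "(\<Sum>w\<in>nb y. f w) = f x + (\<Sum>w\<in>nb y \<inter> N. f w) + (\<Sum>w\<in>nb y \<inter> Z. f w)"
proof -
  have "(\<Sum>w\<in>nb y. f w) = (\<Sum>w\<in>insert x (nb y \<inter> N \<union> nb y \<inter> Z). f w)"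
    using nb_split[OF assms] by simp
  also have "\<dots> = f x + (\<Sum>w\<in>nb y \<inter> N \<union> nb y \<inter> Z. f w)"
    by (rule sum.insert) (auto simp: Z_def)
  also have "(\<Sum>w\<in>nb y \<inter> N \<union> nb y \<inter> Z. f w) = (\<Sum>w\<in>nb y \<inter> N. f w) + (\<Sum>w\<in>nb y \<inter> Z. f w)"
    by (rule sum.union_disjoint) (auto simp: Z_def)
  finally show ?thesis by simp
qed

text \<open>Otherwise every vertex of \<open>Z\<close> has value \<open>t + 1\<close> and is joined
  to all of \<open>N\<close>. Degrees then make \<alpha> constant on \<open>N\<close>, and the
  deficits around one vertex of \<open>N\<close> equate \<open>t * t\<close> with a nonpositive
  product.\<close>

lemma exists_N_le: "\<exists>y\<in>N. \<alpha> y \<le> t + 1"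
proof (rule ccontr)
  assume "\<not> ?thesis"
  then have ge: "\<alpha> y \<ge> t + 2" if "y \<in> N" for y using that by force
  have Z: "\<alpha> z = t + 1" if z: "z \<in> Z" for z
  proof (rule ccontr)
    assume "\<alpha> z \<noteq> t + 1"
    then obtain y where y: "y \<in> N" "z \<notin> nb y" using Z_nonadj_exists[OF z] by blast
    then have "\<alpha> z \<noteq> 1" using nonadj_N_small_le[OF y(1) z y(2)] ge by force
    then show False
      using nonadj_N_Z[OF y(1) z y(2)] ge[OF y(1)] Z_le[OF z] by linarith
  qed
  have Z_nb: "nb y \<inter> Z = Z" if "y \<in> N" for y
    using Z_full[OF _ Z] in_nb_sym in_Z_V that by blast
  have eq: "(\<alpha> y)\<^sup>2 - \<alpha> y = 2 - 2 * t + int (card Z)" if y: "y \<in> N" for y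
    using sum_nb_split[OF y, of "\<lambda>_. 1"] card_nb[OF in_N_V[OF y]] card_nb_N[OF y] Z_nb[OF y]
    by simp
  obtain y where y: "y \<in> N" using card_N t_ge by (cases "N = {}") auto
  have all: "\<alpha> y' = \<alpha> y" if "y' \<in> N" for y'
  proof -
    have "(\<alpha> y' - \<alpha> y) * (\<alpha> y' + \<alpha> y - 1) = 0"
      using eq[OF y] eq[OF that] by (simp add: algebra_simps power2_eq_square)
    then show ?thesis using ge[OF y] ge[OF that] t_ge by simp
  qed
  have s: "s = (t + 1) * \<alpha> y"
    using sum_N card_N all by simp
  have "(\<Sum>w\<in>nb y. t + 1 - \<alpha> w) = t + (\<alpha> y + 1 - t) * (t + 1 - \<alpha> y)"
    using sum_nb_split[OF y, of "\<lambda>w. t + 1 - \<alpha> w"] card_nb_N[OF y] all Z \<alpha>_x by simp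
  then have "(\<alpha> y + 1 - t) * (t + 1 - \<alpha> y) = t * t"
    using sum_deficit[OF in_N_V[OF y]] s by (simp add: algebra_simps power2_eq_square)
  moreover have "(\<alpha> y + 1 - t) * (t + 1 - \<alpha> y) \<le> 0"
    using ge[OF y] by (intro mult_nonneg_nonpos) auto
  moreover have "0 < t * t" using t_ge by simp
  ultimately show False by simp
qed

section \<open>Case analysis on the values of \<alpha> on \<open>N\<close>\<close>

lemma not_mixed_ge_t:
  assumes y0: "y0 \<in> N" "\<alpha> y0 = m" and y1: "y1 \<in> N" "\<alpha> y1 = m + 1"
    and m: "t \<le> m" "m \<le> t + 1"
    and range: "\<And>y. y \<in> N \<Longrightarrow> \<alpha> y = m \<or> \<alpha> y = m + 1"
  shows False
proof -
  define N0 where "N0 = {y \<in> N. \<alpha> y = m}"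
  define N1 where "N1 = {y \<in> N. \<alpha> y = m + 1}"
  have N_eq: "N = N0 \<union> N1" using range by (auto simp: N0_def N1_def)
  have total: "t + 1 \<le> int (card N0) + int (card N1)"
    using card_N card_Un_le[of N0 N1] N_eq by simp
  \<comment> \<open>For \<open>m = t + 1\<close> the right-hand side is negative, so no such pair
    exists; for \<open>m = t\<close> it is 0, so the neighbourhoods are nested.\<close>
  have nonadj: "int (card (nb y - nb y')) = t - m" if "y \<in> N0" "y' \<in> N1" "y' \<notin> nb y" for y y'
  proof -
    have "y \<in> V" "y' \<in> V" "y \<noteq> y'" "\<alpha> y = m" "\<alpha> y' = m + 1"
      using that in_N_V by (auto simp: N0_def N1_def)
    then show ?thesis using card_nb_Diff_nonadj[of y y'] that(3) by simp
  qed
  have sym: "v \<in> nb u \<longleftrightarrow> u \<in> nb v" if "u \<in> N" "v \<in> N" for u v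
    using in_nb_sym in_N_V that by blast
  show False
  proof (cases "m = t")
    case False
    then have m: "m = t + 1" using m by simp
    \<comment> \<open>All pairs between \<open>N0\<close> and \<open>N1\<close> are adjacent, while
      \<open>y0\<close> and \<open>y1\<close> have only 2 and 3 neighbours in
      \<open>N\<close>.\<close>
    have "N1 \<subseteq> nb y0 \<inter> N"
      using nonadj[of y0] m y0 by (force simp: N0_def N1_def)
    then have "card N1 \<le> card (nb y0 \<inter> N)" by (intro card_mono) auto
    moreover have "y \<in> nb y1" if "y \<in> N0" for y
      using nonadj[of y y1] m y1 that sym[of y y1] by (force simp: N0_def N1_def)
    then have "N0 \<subseteq> nb y1 \<inter> N" by (auto simp: N0_def)
    then have "card N0 \<le> card (nb y1 \<inter> N)" by (intro card_mono) auto
    ultimately show False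
      using card_nb_N[OF y0(1)] card_nb_N[OF y1(1)] y0 y1 m total t_ge by simp
  next
    case m: True
    have sub: "nb y \<subseteq> nb y'" if "y \<in> N0" "y' \<in> N1" "y' \<notin> nb y" for y y'
    proof -
      have "card (nb y - nb y') = 0" using nonadj[OF that] m by simp
      then have "nb y - nb y' = {}" by (subst (asm) card_0_eq) auto
      then show ?thesis by blast
    qed
    have deg: "int (card (nb y \<inter> N)) \<le> 2" if "y \<in> N" for y
      using card_nb_N[OF that] range[OF that] m by auto
    have single: "\<exists>p. nb y \<inter> N = {p}" if "y \<in> N0" for y
    proof -
      have "int (card (nb y \<inter> N)) = 1"
        using card_nb_N[of y] that m by (simp add: N0_def)
      then show ?thesis using card_1_singletonE[of "nb y \<inter> N"] by auto
    qed
    have y0': "y0 \<in> N0" and y1': "y1 \<in> N1" using y0 y1 by (auto simp: N0_def N1_def)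
    obtain p where p: "nb y0 \<inter> N = {p}" using single[OF y0'] by blast
    \<comment> \<open>A vertex of \<open>N1\<close> not adjacent to \<open>y0\<close> inherits
      \<open>p\<close>, the only neighbour of \<open>y0\<close> in \<open>N\<close>.\<close>
    have "N1 \<subseteq> insert p (nb p \<inter> N)"
    proof
      fix y assume y: "y \<in> N1"
      then have yN: "y \<in> N" by (simp add: N1_def)
      show "y \<in> insert p (nb p \<inter> N)"
      proof (cases "y \<in> nb y0")
        case True
        then show ?thesis using p yN by blast
      next
        case False
        have pN: "p \<in> N" "p \<in> nb y0" using p by auto
        then have "p \<in> nb y" using sub[OF y0' y False] by blast
        then show ?thesis using sym[OF yN pN(1)] yN by blast
      qed
    qed
    then have "card N1 \<le> card (insert p (nb p \<inter> N))" by (intro card_mono) auto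
    also have "\<dots> \<le> Suc (card (nb p \<inter> N))" by (rule card_insert_le_m1) auto
    also have "card (nb p \<inter> N) \<le> 2" using deg[of p] p by auto
    finally have N1: "card N1 \<le> 3" by simp
    \<comment> \<open>These vertices are two steps away from \<open>y1\<close> inside
      \<open>N\<close>. A vertex of \<open>N0\<close> not adjacent to \<open>y1\<close> shares its
      single neighbour in \<open>N\<close> with \<open>y1\<close>, hence \<open>N0\<close> has at
      most 4 elements. With at most 3 in \<open>N1\<close> this falls short of \<open>t + 1\<close>,
      which is at least 8.\<close>
    let ?U = "\<Union>v\<in>nb y1 \<inter> N. nb v \<inter> N - {y1}"
    have "N0 \<subseteq> (nb y1 \<inter> N) \<union> ?U"
    proof
      fix y assume y: "y \<in> N0"
      then have yN: "y \<in> N" "y \<noteq> y1" using y1 by (auto simp: N0_def)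
      show "y \<in> (nb y1 \<inter> N) \<union> ?U"
      proof (cases "y1 \<in> nb y")
        case True
        then show ?thesis using sym[OF yN(1) y1(1)] yN by blast
      next
        case False
        obtain p where p: "nb y \<inter> N = {p}" using single[OF y] by blast
        then have pN: "p \<in> N" "p \<in> nb y" by auto
        have "p \<in> nb y1" using sub[OF y y1' False] pN by blast
        moreover have "y \<in> nb p" using sym[OF yN(1) pN(1)] pN by blast
        ultimately show ?thesis using yN pN by blast
      qed
    qed
    then have "card N0 \<le> card ((nb y1 \<inter> N) \<union> ?U)" by (intro card_mono) auto
    also have "\<dots> \<le> card (nb y1 \<inter> N) + card ?U" by (rule card_Un_le)
    also have "card ?U \<le> (\<Sum>v\<in>nb y1 \<inter> N. card (nb v \<inter> N - {y1}))" by (rule card_UN_le) simp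
    also have "\<dots> \<le> (\<Sum>v\<in>nb y1 \<inter> N. 1)"
    proof (rule sum_mono)
      fix v assume v: "v \<in> nb y1 \<inter> N"
      then have "y1 \<in> nb v" using sym y1(1) by blast
      then show "card (nb v \<inter> N - {y1}) \<le> 1" using deg[of v] v y1(1) by simp
    qed
    finally have "card N0 \<le> 4" using deg[OF y1(1)] by simp
    then show False using total N1 t_ge by simp
  qed
qed

text \<open>Edges between \<open>N\<close> and \<open>Z\<close>, weighted by the deficit at the end
  in \<open>Z\<close>, are counted twice. From \<open>N\<close> the total is -1 modulo
  \<open>t\<close>; from \<open>Z\<close> every term is a multiple of \<open>t\<close>, since the
  values there are 1, \<open>t\<close> or \<open>t + 1\<close>.\<close>

lemma constant_t_impossible:
  assumes const: "\<And>y. y \<in> N \<Longrightarrow> \<alpha> y = t"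
  shows False
proof -
  have s: "s = (t + 1) * t" using sum_N card_N const by simp
  have inner: "(\<Sum>z\<in>nb y \<inter> Z. t + 1 - \<alpha> z) = t * t - 1" if y: "y \<in> N" for y
  proof -
    have "(\<Sum>w\<in>nb y \<inter> N. t + 1 - \<alpha> w) = 1"
      using card_nb_N[OF y] const y by simp
    then show ?thesis
      using sum_nb_split[OF y, of "\<lambda>w. t + 1 - \<alpha> w"] sum_deficit[OF in_N_V[OF y]] \<alpha>_x const[OF y] s
      by (simp add: algebra_simps power2_eq_square)
  qed
  have "(\<Sum>z\<in>Z. \<alpha> z * (t + 1 - \<alpha> z)) = (\<Sum>z\<in>Z. \<Sum>y\<in>{y \<in> N. z \<in> nb y}. t + 1 - \<alpha> z)"
  proof (rule sum.cong)
    fix z assume z: "z \<in> Z"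
    have "{y \<in> N. z \<in> nb y} = nb z \<inter> N"
      using in_nb_sym in_N_V in_Z_V z by blast
    then show "\<alpha> z * (t + 1 - \<alpha> z) = (\<Sum>y\<in>{y \<in> N. z \<in> nb y}. t + 1 - \<alpha> z)"
      using card_nb_Z[OF z] by simp
  qed simp
  also have "\<dots> = (\<Sum>y\<in>N. \<Sum>z\<in>{z \<in> Z. z \<in> nb y}. t + 1 - \<alpha> z)"
    by (rule sum.swap_restrict) auto
  also have "\<dots> = (\<Sum>y\<in>N. t * t - 1)"
    by (rule sum.cong) (use inner in \<open>auto simp: Int_def conj_commute\<close>)
  also have "\<dots> = t * (t * t + t - 1) - 1"
    using card_N by (simp add: algebra_simps)
  finally have sum: "(\<Sum>z\<in>Z. \<alpha> z * (t + 1 - \<alpha> z)) = t * (t * t + t - 1) - 1" .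
  have "t dvd (\<Sum>z\<in>Z. \<alpha> z * (t + 1 - \<alpha> z))"
  proof (rule dvd_sum)
    fix z assume "z \<in> Z"
    then have "\<alpha> z = 1 \<or> \<alpha> z = t + 1 \<or> \<alpha> z = t"
      using Z_values[of z] const t_ge by force
    then show "t dvd \<alpha> z * (t + 1 - \<alpha> z)" by auto
  qed
  then have "t dvd t * (t * t + t - 1) - (t * (t * t + t - 1) - 1)"
    unfolding sum by (rule dvd_diff[OF dvd_triv_left])
  also have "\<dots> = 1" by simp
  finally have "t dvd 1" .
  then show False using t_ge by auto
qed

text \<open>Neighbours of weight-one vertices all have value \<open>t - 1\<close>, so
  \<open>v\<close> has no neighbour of weight one. The eigenvector equation at \<open>v\<close> then
  leaves only \<open>\<alpha> v = t\<close> with all neighbours of value \<open>t - 1\<close>, and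
  the equation at a vertex of \<open>N\<close> that misses \<open>v\<close> fails.\<close>

lemma constant_t_minus_1_impossible:
  assumes const: "\<And>y. y \<in> N \<Longrightarrow> \<alpha> y = t - 1"
    and v: "v \<in> V" "\<alpha> v \<noteq> 1" "\<alpha> v \<noteq> t - 1"
  shows False
proof -
  have s: "s = (t + 1) * (t - 1)" using sum_N card_N const by simp
  have small_nb: "\<alpha> w = t - 1" if x': "x' \<in> V" "\<alpha> x' = 1" and w: "w \<in> nb x'" for x' w
  proof -
    \<comment> \<open>Any weight-one vertex can replace \<open>x\<close>: its \<open>t + 1\<close>
      neighbours have values at least \<open>t - 1\<close>, and their sum \<open>s\<close> is the
      least possible.\<close>
    interpret x': rank_one_graph_small V adj \<alpha> s t x' using x' by unfold_locales
    have "(\<Sum>w\<in>x'.N. \<alpha> w - (t - 1)) = 0"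
      using x'.sum_N x'.card_N s by (simp add: sum_subtractf)
    then show ?thesis
      using w x'.N_ge by (subst (asm) sum_nonneg_eq_0_iff) (auto simp: x'.N_def)
  qed
  have vals: "\<alpha> w = 1 \<or> \<alpha> w = t - 1 \<or> \<alpha> w = t \<or> \<alpha> w = t + 1" if "w \<in> V" for w
    using that
    by (cases rule: V_cases) (use \<alpha>_x const Z_values[of w] in force)+
  have vZ: "v \<in> Z" using v(1) by (cases rule: V_cases) (use v(2,3) \<alpha>_x const in auto)
  have nb_v: "\<alpha> w \<ge> t - 1" if w: "w \<in> nb v" for w
  proof -
    have wV: "w \<in> V" using w nb_subset by blast
    then have "\<alpha> w \<noteq> 1" using small_nb[OF wV _ in_nb_sym[OF v(1) w]] v(3) by blast
    then show ?thesis using vals[OF wV] by linarith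
  qed
  \<comment> \<open>The last factor is \<open>(\<alpha> v - 1) * (t - \<alpha> v)\<close>, negative
    at \<open>t + 1\<close> and zero at \<open>t\<close>.\<close>
  have sum_v: "(\<Sum>w\<in>nb v. \<alpha> w - (t - 1)) = (t - 1) * ((t + 1) * \<alpha> v - t - (\<alpha> v)\<^sup>2)"
  proof -
    have "(\<Sum>w\<in>nb v. \<alpha> w - (t - 1)) = (\<Sum>w\<in>nb v. \<alpha> w) - int (card (nb v)) * (t - 1)"
      by (simp only: sum_subtractf sum_constant of_nat_id right_diff_distrib)
    then show ?thesis
      unfolding sum_nb[OF v(1)] card_nb[OF v(1)] s by (simp add: algebra_simps)
  qed
  have "0 \<le> (\<Sum>w\<in>nb v. \<alpha> w - (t - 1))" using nb_v by (intro sum_nonneg) simp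
  then have ge: "0 \<le> (t + 1) * \<alpha> v - t - (\<alpha> v)\<^sup>2"
    using sum_v t_ge by (simp add: zero_le_mult_iff)
  then have "\<alpha> v \<noteq> t + 1" using t_ge by (auto simp: power2_eq_square)
  then have vt: "\<alpha> v = t" using vals[OF v(1)] v by blast
  then have "(\<Sum>w\<in>nb v. \<alpha> w - (t - 1)) = 0"
    unfolding sum_v by (simp add: algebra_simps power2_eq_square)
  then have nb_v_eq: "\<alpha> w = t - 1" if "w \<in> nb v" for w
    using that nb_v by (subst (asm) sum_nonneg_eq_0_iff) auto
  obtain y where y: "y \<in> N" "v \<notin> nb y" using Z_nonadj_exists[OF vZ] vt by auto
  have yV: "y \<in> V" and ay: "\<alpha> y = t - 1" using y const in_N_V by auto
  have "y \<noteq> v" using y(1) vZ N_Z_disjoint by blast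
  \<comment> \<open>So \<open>x\<close> is the only neighbour of \<open>y\<close> outside
    \<open>nb v\<close>, and all other neighbours of \<open>y\<close> have value
    \<open>t - 1\<close>.\<close>
  then have "int (card (nb y - nb v)) = 1"
    using card_nb_Diff_nonadj[OF yV v(1) _ y(2)] ay vt by simp
  then obtain q where "nb y - nb v = {q}" using card_1_singletonE[of "nb y - nb v"] by auto
  moreover have "x \<in> nb y - nb v" using x_in_nb[OF y(1)] x_notin_nb_Z[OF vZ] by simp
  ultimately have diff: "nb y - nb v = {x}" by auto
  have "(\<Sum>w\<in>nb y. \<alpha> w) = \<alpha> x + (\<Sum>w\<in>nb y - {x}. \<alpha> w)"
    using x_in_nb[OF y(1)] by (intro sum.remove) auto
  also have "(\<Sum>w\<in>nb y - {x}. \<alpha> w) = (\<Sum>w\<in>nb y - {x}. t - 1)"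
    by (rule sum.cong) (use nb_v_eq diff in auto)
  also have "\<dots> = (int (card (nb y)) - 1) * (t - 1)"
  proof -
    have "card (nb y) = Suc (card (nb y - {x}))"
      using x_in_nb[OF y(1)] by (intro card.remove) auto
    then show ?thesis by simp
  qed
  finally have "s * (t - 1) = 1 + (t + (t - 1)\<^sup>2 - 1) * (t - 1)"
    using sum_nb[OF yV] card_nb[OF yV] ay \<alpha>_x by simp
  then have "(t - 1) * (t - 1) = 1"
    unfolding s by (simp add: algebra_simps power2_eq_square)
  moreover have "6 * 6 \<le> (t - 1) * (t - 1)" using t_ge by (intro mult_mono) auto
  ultimately show False by simp
qed

text \<open>Comparing neighbourhoods shows that \<open>N\<close> has just two vertices of value
  \<open>t\<close>, which fixes \<open>s\<close>; the deficits around \<open>y0\<close> and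
  \<open>y1\<close> are then incompatible.\<close>

lemma not_mixed_t_minus_1:
  assumes y0: "y0 \<in> N" "\<alpha> y0 = t - 1" and y1: "y1 \<in> N" "\<alpha> y1 = t"
    and range: "\<And>y. y \<in> N \<Longrightarrow> \<alpha> y = t - 1 \<or> \<alpha> y = t"
  shows False
proof -
  \<comment> \<open>A weight-one vertex of \<open>Z\<close> has exactly one neighbour in
    \<open>N\<close>, and a vertex of weight \<open>t\<close> exactly one non-neighbour there. So
    \<open>Om y\<close> and \<open>P y\<close> are private to \<open>y\<close>.\<close>
  define Om where "Om = (\<lambda>y. {z \<in> Z. \<alpha> z = 1 \<and> z \<in> nb y})"
  define P where "P = (\<lambda>y. {z \<in> Z. \<alpha> z = t \<and> z \<notin> nb y})"
  have [simp]: "finite (Om y)" "finite (P y)" for y by (simp_all add: Om_def P_def)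
  have Om_P_disjoint: "Om y \<inter> P y' = {}" for y y' using t_ge by (auto simp: Om_def P_def)
  have sym: "v \<in> nb u \<longleftrightarrow> u \<in> nb v" if "u \<in> V" "v \<in> V" for u v
    using in_nb_sym that by blast
  have Om_not_nb: "z \<notin> nb y'" if "z \<in> Om y" "y \<in> N" "y' \<in> N" "y' \<noteq> y" for z y y'
  proof
    assume "z \<in> nb y'"
    have z: "z \<in> Z" "\<alpha> z = 1" "z \<in> nb y" using that(1) by (auto simp: Om_def)
    have "{y, y'} \<subseteq> nb z \<inter> N"
      using sym in_Z_V[OF z(1)] in_N_V that z(3) \<open>z \<in> nb y'\<close> by blast
    then have "card {y, y'} \<le> card (nb z \<inter> N)" by (intro card_mono) auto
    then show False using card_nb_Z[OF z(1)] z(2) that(4) by simp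
  qed
  have P_nb: "z \<in> nb y" if "z \<in> P y'" "y \<in> N" "y' \<in> N" "y' \<noteq> y" for z y y'
  proof (rule ccontr)
    assume "z \<notin> nb y"
    have z: "z \<in> Z" "\<alpha> z = t" "z \<notin> nb y'" using that(1) by (auto simp: P_def)
    have "nb z \<inter> N \<subseteq> N - {y, y'}"
      using sym in_Z_V[OF z(1)] in_N_V that z(3) \<open>z \<notin> nb y\<close> by blast
    then have "card (nb z \<inter> N) \<le> card (N - {y, y'})" by (intro card_mono) auto
    also have "card (N - {y, y'}) = card N - 2"
      using that by (subst card_Diff_subset) auto
    finally show False using card_nb_Z[OF z(1)] z(2) card_N t_ge by simp
  qed
  have Z_part: "(nb y - nb y') \<inter> Z = Om y \<union> P y'"
    if y: "y \<in> N" "y' \<in> N" "y \<noteq> y'" "\<alpha> y' = t" for y y'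
  proof
    show "Om y \<union> P y' \<subseteq> (nb y - nb y') \<inter> Z"
      using Om_not_nb[OF _ y(1,2)] P_nb[OF _ y(1,2)] y(3) by (auto simp: Om_def P_def)
    show "(nb y - nb y') \<inter> Z \<subseteq> Om y \<union> P y'"
    proof
      fix z assume z: "z \<in> (nb y - nb y') \<inter> Z"
      then have "\<alpha> z = 1 \<or> \<alpha> z = t" using nonadj_N_Z[OF y(2), of z] y(4) by auto
      then show "z \<in> Om y \<union> P y'" using z by (auto simp: Om_def P_def)
    qed
  qed
  have diff_eq: "nb y - nb y' = (nb y \<inter> N - nb y') \<union> (Om y \<union> P y')"
    if y: "y \<in> N" "y' \<in> N" "y \<noteq> y'" "\<alpha> y' = t" for y y'
  proof -
    have "w \<in> N \<union> Z" if "w \<in> nb y - nb y'" for w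
    proof -
      have "w \<in> V" using that nb_subset by blast
      then show ?thesis by (cases rule: V_cases) (use that x_in_nb[OF y(2)] in auto)
    qed
    then have "nb y - nb y' = (nb y \<inter> N - nb y') \<union> ((nb y - nb y') \<inter> Z)" by blast
    then show ?thesis unfolding Z_part[OF y] .
  qed
  have card_Om_P: "card (Om y \<union> P y') = card (Om y) + card (P y')" for y y'
    by (rule card_Un_disjoint) (use Om_P_disjoint in auto)
  \<comment> \<open>As \<open>y0\<close> has no neighbour in \<open>N\<close>, the single element of
    \<open>nb y0 - nb y\<close> lies in \<open>Z\<close>. Consequently \<open>card (P y)\<close> is
    the same for all \<open>y\<close> of value \<open>t\<close>.\<close>
  have P_card: "card (Om y0) + card (P y) = 1" if y: "y \<in> N" "\<alpha> y = t" for y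
  proof -
    have "int (card (nb y0 \<inter> N)) = 0" using card_nb_N[OF y0(1)] y0(2) by simp
    then have "nb y0 \<inter> N = {}" by simp
    moreover have ne: "y0 \<noteq> y" using y y0 by auto
    ultimately have "nb y0 - nb y = Om y0 \<union> P y" and "y \<notin> nb y0"
      using diff_eq[OF y0(1) y(1) _ y(2)] y(1) by auto
    moreover have "int (card (nb y0 - nb y)) = 1"
      using card_nb_Diff_nonadj[OF in_N_V[OF y0(1)] in_N_V[OF y(1)] ne \<open>y \<notin> nb y0\<close>] y y0 by simp
    ultimately show ?thesis using card_Om_P[of y0 y] by simp
  qed
  have "int (card (nb y1 \<inter> N)) = 1" using card_nb_N[OF y1(1)] y1(2) by simp
  then obtain p where p: "nb y1 \<inter> N = {p}" using card_1_singletonE[of "nb y1 \<inter> N"] by auto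
  then have pN: "p \<in> N" "p \<in> nb y1" by auto
  then have y1p: "y1 \<in> nb p" "p \<noteq> y1" using in_nb_sym[OF in_N_V[OF y1(1)]] by auto
  have "card {y1} \<le> card (nb p \<inter> N)" using y1p y1(1) by (intro card_mono) auto
  then have pt: "\<alpha> p = t" using card_nb_N[OF pN(1)] range[OF pN(1)] by auto
  \<comment> \<open>The case \<open>y = p\<close> is included and gives the count
    \<open>2 * t - 1\<close>, while a \<open>y\<close> not adjacent to \<open>y1\<close> gives
    \<open>t\<close>. Since \<open>card (P y)\<close> is constant, no such nonadjacent
    \<open>y\<close> exists.\<close>
  have Om_card: "int (card (nb y1 - nb y)) = 1 + int (card (Om y1)) + int (card (P y))"
    if y: "y \<in> N" "y \<noteq> y1" "\<alpha> y = t" for y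
  proof -
    have "p \<notin> nb y"
    proof
      assume "p \<in> nb y"
      then have "{y1, y} \<subseteq> nb p \<inter> N" using in_nb_sym[OF in_N_V[OF y(1)]] y1p y y1 by blast
      then have "card {y1, y} \<le> card (nb p \<inter> N)" by (intro card_mono) auto
      then show False using card_nb_N[OF pN(1)] pt y(2) by simp
    qed
    then have "nb y1 - nb y = insert p (Om y1 \<union> P y)"
      using diff_eq[OF y1(1) y(1) y(2)[symmetric] y(3)] p by auto
    moreover have "p \<notin> Om y1 \<union> P y" using pN(1) N_Z_disjoint by (auto simp: Om_def P_def)
    ultimately show ?thesis using card_Om_P[of y1 y] by simp
  qed
  have Om_p: "1 + int (card (Om y1)) + int (card (P p)) = 2 * t - 1"
    using Om_card[OF pN(1) y1p(2) pt] card_nb_Diff_adj[OF in_N_V[OF y1(1)] pN(2)] y1 pt by simp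
  have only: "y = y1 \<or> y = p" if y: "y \<in> N" "\<alpha> y = t" for y
  proof (rule ccontr)
    assume ne: "\<not> ?thesis"
    then have "y \<notin> nb y1" using p y by blast
    then have "1 + int (card (Om y1)) + int (card (P y)) = t"
      using Om_card[of y] ne y card_nb_Diff_nonadj[OF in_N_V[OF y1(1)] in_N_V[OF y(1)]] y1 by simp
    moreover have "card (P y) = card (P p)" using P_card[OF y] P_card[OF pN(1) pt] by simp
    ultimately show False using Om_p t_ge by simp
  qed
  have s: "s = t * t + 1"
  proof -
    have pair: "{y. y = y1 \<or> y = p} = {y1, p}" by auto
    have "s = (\<Sum>y\<in>N. (t - 1) + (if y \<in> {y1, p} then 1 else 0))"
      unfolding sum_N[symmetric] using only range y1 pt by (intro sum.cong) force+
    also have "\<dots> = (t + 1) * (t - 1) + int (card ({y1, p} \<inter> N))"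
      unfolding sum.distrib using card_N
      by (simp add: sum.If_cases Int_commute pair)
    also have "{y1, p} \<inter> N = {y1, p}" using y1 pN by blast
    finally show ?thesis using y1p(2) by (simp add: algebra_simps)
  qed
  have \<alpha>_le: "\<alpha> w \<le> t + 1" if "w \<in> V" for w
    using that
    by (cases rule: V_cases) (use \<alpha>_x range[of w] Z_le[of w] t_ge in auto)
  have ne: "y0 \<noteq> y1" using y0 y1 by auto
  \<comment> \<open>All deficits \<open>?d w\<close> are nonnegative. Those of weight-one vertices use up almost the whole
    deficit around \<open>y1\<close>, and \<open>y0\<close> shares all but one of its neighbours with \<open>y1\<close>.\<close>
  let ?d = "\<lambda>w. t + 1 - \<alpha> w"
  have split: "(\<Sum>w\<in>nb u. ?d w) = (\<Sum>w\<in>nb u \<inter> nb v. ?d w) + (\<Sum>w\<in>nb u - nb v. ?d w)" for u v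
    by (rule sum.Int_Diff) simp
  have "t * (2 * t - 3) \<le> t * int (card (Om y1))"
    using Om_p P_card[OF pN(1) pt] t_ge by (intro mult_left_mono) auto
  also have "\<dots> = (\<Sum>w\<in>Om y1. ?d w)" by (simp add: Om_def mult.commute)
  also have "\<dots> \<le> (\<Sum>w\<in>nb y1 - nb y0. ?d w)"
  proof (rule sum_mono2)
    show "Om y1 \<subseteq> nb y1 - nb y0"
      using Om_not_nb[OF _ y1(1) y0(1) ne] by (auto simp: Om_def)
  qed (use \<alpha>_le nb_subset in force)+
  finally have "(\<Sum>w\<in>nb y1 \<inter> nb y0. ?d w) \<le> 3 * t"
    using split[of y1 y0] sum_deficit[OF in_N_V[OF y1(1)]] y1(2) s
    by (simp add: algebra_simps power2_eq_square)
  moreover have "(\<Sum>w\<in>nb y0 - nb y1. ?d w) \<le> t"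
  proof -
    have "y1 \<notin> nb y0"
    proof
      assume "y1 \<in> nb y0"
      then have "card {y1} \<le> card (nb y0 \<inter> N)" using y1(1) by (intro card_mono) auto
      then show False using card_nb_N[OF y0(1)] y0(2) by simp
    qed
    then have "int (card (nb y0 - nb y1)) = 1"
      using card_nb_Diff_nonadj[OF in_N_V[OF y0(1)] in_N_V[OF y1(1)] ne] y1 y0 by simp
    moreover have "(\<Sum>w\<in>nb y0 - nb y1. ?d w) \<le> (\<Sum>w\<in>nb y0 - nb y1. t)"
      using \<alpha>_pos nb_subset by (intro sum_mono) force
    ultimately show ?thesis by simp
  qed
  moreover have "(\<Sum>w\<in>nb y0. ?d w) = t * t - t + 2"
    using sum_deficit[OF in_N_V[OF y0(1)]] y0(2) s by (simp add: algebra_simps power2_eq_square)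
  ultimately have "t * t - t + 2 \<le> 4 * t"
    using split[of y0 y1] by (simp add: Int_commute)
  moreover have "7 * t \<le> t * t" using t_ge by (intro mult_right_mono) auto
  ultimately show False using t_ge by simp
qed

theorem only_two_values: "\<exists>c. \<forall>v\<in>V. \<alpha> v = 1 \<or> \<alpha> v = c"
proof -
  have ne: "N \<noteq> {}" using card_N t_ge by auto
  define m where "m = Min (\<alpha> ` N)"
  have "m \<in> \<alpha> ` N" unfolding m_def using ne by (intro Min_in) auto
  then obtain y0 where y0: "y0 \<in> N" "\<alpha> y0 = m" by blast
  have m_le: "m \<le> \<alpha> y" if "y \<in> N" for y unfolding m_def using that by (intro Min_le) auto
  have range: "\<alpha> y = m \<or> \<alpha> y = m + 1" if "y \<in> N" for y
    using m_le[OF that] N_diff_le_1[OF y0(1) that] y0(2) by linarith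
  have "m \<le> t + 1" using exists_N_le m_le by force
  moreover have "t - 1 \<le> m" using N_ge[OF y0(1)] y0(2) by simp
  ultimately consider "m = t - 1" | "m = t" | "m = t + 1" by linarith
  note m_cases = this
  have m: "\<alpha> y = m" if y: "y \<in> N" for y
  proof (rule ccontr)
    assume "\<alpha> y \<noteq> m"
    then have y': "\<alpha> y = m + 1" using range[OF y] by simp
    show False
      using m_cases
    proof cases
      case 1
      then show False using not_mixed_t_minus_1[OF y0(1) _ y] y0(2) y' range by auto
    next
      case 2
      then show False using not_mixed_ge_t[OF y0 y y' _ _ range] by simp
    next
      case 3
      then show False using not_mixed_ge_t[OF y0 y y' _ _ range] by simp
    qed
  qed
  show ?thesis
    using m_cases
  proof cases
    case 1
    then show ?thesis using constant_t_minus_1_impossible m by blast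
  next
    case 2
    then show ?thesis using constant_t_impossible m by blast
  next
    case 3
    have N: "\<alpha> ` N \<subseteq> {t + 1}" using m 3 by auto
    have "\<alpha> v = 1 \<or> \<alpha> v = t + 1" if "v \<in> V" for v
      using that
    proof (cases rule: V_cases)
      case 1
      then show ?thesis using \<alpha>_x by simp
    next
      case 2
      then show ?thesis using N by blast
    next
      case 3
      have "t - 1 \<notin> \<alpha> ` N" using N by auto
      then show ?thesis using Z_values[OF 3] N by blast
    qed
    then show ?thesis by blast
  qed
qed

end

section \<open>The adjacency spectrum\<close>

text \<open>Without parallel arcs, \<open>head\<close> is injective on the arcs leaving
  \<open>u\<close>.\<close>

lemma (in graph) out_degree_eq_card: "out_degree G u = card {w \<in> verts G. u \<rightarrow>\<^bsub>G\<^esub> w}"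
proof -
  have "bij_betw (head G) (out_arcs G u) {w \<in> verts G. u \<rightarrow>\<^bsub>G\<^esub> w}"
  proof (rule bij_betw_imageI)
    show "inj_on (head G) (out_arcs G u)"
      by (rule inj_onI) (auto simp: arc_to_ends_def intro: no_multi_arcs)
    show "head G ` out_arcs G u = {w \<in> verts G. u \<rightarrow>\<^bsub>G\<^esub> w}"
      by (auto simp: arcs_ends_conv)
  qed
  then show ?thesis unfolding out_degree_def by (rule bij_betw_same_card)
qed

text \<open>Reindexing along \<open>vs\<close> turns vectors into functions on vertices; the support
  condition makes nonzero vectors correspond to nonzero functions.\<close>

lemma eigenvalue_adjacency_matrix_iff:
  assumes vs: "vertex_enumeration G vs"
  shows "eigenvalue (adjacency_matrix G vs) l \<longleftrightarrow>
    (\<exists>v. (\<forall>i. i \<notin> verts G \<longrightarrow> v i = 0) \<and> v \<noteq> (\<lambda>i. 0) \<and>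
      (\<forall>u\<in>verts G. (\<Sum>w\<in>verts G. of_bool (u \<rightarrow>\<^bsub>G\<^esub> w) * v w) = l * v u))"
    (is "_ \<longleftrightarrow> (\<exists>v. ?supp v \<and> _ \<and> ?eq v)")
proof -
  define n where "n = length vs"
  have dist: "distinct vs" and set: "set vs = verts G"
    using vs by (auto simp: vertex_enumeration_def)
  have bij: "bij_betw (\<lambda>i. vs ! i) {0..<n} (verts G)"
    by (rule bij_betw_nth[OF dist]) (auto simp: set n_def)
  have nth_mem: "vs ! i \<in> verts G" if "i < n" for i
    using that by (simp add: n_def flip: set)
  have dim: "dim_row (adjacency_matrix G vs) = n"
    by (simp add: adjacency_matrix_def n_def)
  have mult: "(adjacency_matrix G vs *\<^sub>v vec n (\<lambda>i. v (vs ! i))) $ i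
      = (\<Sum>w\<in>verts G. of_bool (vs ! i \<rightarrow>\<^bsub>G\<^esub> w) * v w)" if "i < n" for v i
  proof -
    have "(adjacency_matrix G vs *\<^sub>v vec n (\<lambda>i. v (vs ! i))) $ i
        = (\<Sum>j\<in>{0..<n}. of_bool (vs ! i \<rightarrow>\<^bsub>G\<^esub> vs ! j) * v (vs ! j))"
      using that by (simp add: adjacency_matrix_def n_def scalar_prod_def of_bool_def if_distrib cong: if_cong)
    also have "\<dots> = (\<Sum>w\<in>verts G. of_bool (vs ! i \<rightarrow>\<^bsub>G\<^esub> w) * v w)"
      by (rule sum.reindex_bij_betw[OF bij])
    finally show ?thesis .
  qed
  have all_iff: "(\<forall>i<n. Q (vs ! i)) \<longleftrightarrow> (\<forall>u\<in>verts G. Q u)" for Q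
    unfolding set[symmetric] n_def by (simp add: all_set_conv_all_nth)
  have iff: "eigenvector (adjacency_matrix G vs) (vec n (\<lambda>i. v (vs ! i))) l \<longleftrightarrow>
      v \<noteq> (\<lambda>i. 0) \<and> ?eq v" if supp: "?supp v" for v
  proof -
    have "vec n (\<lambda>i. v (vs ! i)) = 0\<^sub>v n \<longleftrightarrow> (\<forall>i<n. v (vs ! i) = 0)"
      by (auto simp: vec_eq_iff)
    also have "\<dots> \<longleftrightarrow> (\<forall>u\<in>verts G. v u = 0)" by (rule all_iff)
    also have "\<dots> \<longleftrightarrow> v = (\<lambda>i. 0)" using supp by (auto simp: fun_eq_iff)
    finally have "vec n (\<lambda>i. v (vs ! i)) = 0\<^sub>v n \<longleftrightarrow> v = (\<lambda>i. 0)" .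
    moreover have "adjacency_matrix G vs *\<^sub>v vec n (\<lambda>i. v (vs ! i)) = l \<cdot>\<^sub>v vec n (\<lambda>i. v (vs ! i))
      \<longleftrightarrow> (\<forall>i<n. (\<Sum>w\<in>verts G. of_bool (vs ! i \<rightarrow>\<^bsub>G\<^esub> w) * v w) = l * v (vs ! i))"
      using dim mult by (auto simp: vec_eq_iff simp del: index_mult_mat_vec)
    moreover have "\<dots> \<longleftrightarrow> ?eq v" by (rule all_iff)
    ultimately show ?thesis unfolding eigenvector_def dim by simp
  qed
  show ?thesis
  proof
    assume "eigenvalue (adjacency_matrix G vs) l"
    then obtain x where x: "eigenvector (adjacency_matrix G vs) x l" by (auto simp: eigenvalue_def)
    then have dim_x: "x \<in> carrier_vec n" by (simp add: eigenvector_def dim)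
    define v where "v = (\<lambda>u. if u \<in> verts G then x $ the_inv_into {0..<n} (\<lambda>i. vs ! i) u else 0)"
    have supp: "?supp v" by (simp add: v_def)
    have "vec n (\<lambda>i. v (vs ! i)) = x"
      using dim_x bij nth_mem by (auto simp: v_def the_inv_into_f_f bij_betw_def)
    then show "\<exists>v. ?supp v \<and> v \<noteq> (\<lambda>i. 0) \<and> ?eq v" using iff[OF supp] supp x by auto
  qed (use iff in \<open>auto simp: eigenvalue_def\<close>)
qed

text \<open>A root of a monic integer polynomial is an algebraic integer, and the rational ones are
  integers.\<close>

lemma rational_root_monic_quadratic_int:
  fixes r :: real and b c :: int
  assumes "r \<in> \<rat>" and "r\<^sup>2 + of_int b * r + of_int c = 0"
  shows "r \<in> \<int>"
proof (rule rational_algebraic_int_is_int[OF _ assms(1)])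
  show "algebraic_int r"
    unfolding algebraic_int_altdef_ipoly
  proof (intro exI conjI)
    show "poly (map_poly of_int [:c, b, 1:]) r = 0"
      using assms(2) by (simp add: map_poly_pCons algebra_simps power2_eq_square)
  qed simp
qed

section \<open>Integrality and passage to the combinatorial setting\<close>

theorem theorem4p10:
  fixes s t :: real
    and \<Gamma> :: "('a, 'b) pre_digraph"
    and vs :: "'a list"
  assumes "t \<ge> 7"
    and "graph \<Gamma>"
    and "Digraph_Component.connected \<Gamma>"
    and "\<not> regular_graph \<Gamma>"
    and "vertex_enumeration \<Gamma> vs"
    and "spectrum (adjacency_matrix \<Gamma> vs) = {s, 1, -t}"
    and "s > 1" and "1 > -t"
    and "\<not> cone_graph \<Gamma>"
    and "\<not> biregular_graph \<Gamma>"
  shows "real (min_valency \<Gamma>) \<ge> t + 2"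
proof (rule ccontr)
  assume "\<not> ?thesis"
  then have min_less: "real (min_valency \<Gamma>) < t + 2" by simp
  interpret graph \<Gamma> by fact
  define V where "V = verts \<Gamma>"
  define adj where "adj = (\<lambda>u v. u \<rightarrow>\<^bsub>\<Gamma>\<^esub> v)"
  define a :: "'a \<Rightarrow> 'a \<Rightarrow> real" where "a = (\<lambda>u v. of_bool (adj u v))"
  have adj_sym: "adj u v \<longleftrightarrow> adj v u" for u v
    using arcs_ends_symmetric[OF sym_arcs] by (auto simp: adj_def)
  have adj_irrefl: "\<not> adj u u" for u
    using adj_not_same by (auto simp: adj_def)
  have fin: "finite V" by (simp add: V_def)
  interpret irreducible_kernel V a
  proof
    fix S assume S: "S \<subseteq> V" "S \<noteq> {}" "\<And>i j. i \<in> S \<Longrightarrow> j \<in> V \<Longrightarrow> a i j \<noteq> 0 \<Longrightarrow> j \<in> S"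
    obtain u where u: "u \<in> S" using S(2) by blast
    have "v \<in> S" if v: "v \<in> V" for v
    proof -
      \<comment> \<open>Connectedness is defined through the symmetric closure, whose reachability
        agrees with that of a symmetric digraph.\<close>
      have "u \<rightarrow>\<^sup>*\<^bsub>mk_symmetric \<Gamma>\<^esub> v"
        using assms(3) u v S(1) by (auto simp: connected_def strongly_connected_def V_def)
      then have "u \<rightarrow>\<^sup>*\<^bsub>\<Gamma>\<^esub> v" using reachable_mk_symmetric_eq[OF sym_arcs] by simp
      then show ?thesis
      proof (induction rule: reachable_induct)
        case (step y z)
        then show ?case
          using S(3)[of y z] adj_in_verts(2)[of y z] by (simp add: a_def adj_def V_def)
      qed (use u in simp)
    qed
    then show "S = V" using S(1) by blast
  qed (use fin adj_sym in \<open>auto simp: a_def\<close>)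
  have shifted_iff: "shifted l v = (\<lambda>i. 0) \<longleftrightarrow> (\<forall>u\<in>V. (\<Sum>w\<in>V. a u w * v w) = l * v u)" for l v
    by (auto simp: shifted_def fun_eq_iff)
  have spec: "l \<in> {s, 1, -t} \<longleftrightarrow> (\<exists>v. vanishing v \<and> v \<noteq> (\<lambda>i. 0) \<and> shifted l v = (\<lambda>i. 0))" for l
  proof -
    have "eigenvalue (adjacency_matrix \<Gamma> vs) l \<longleftrightarrow> (\<exists>v. (\<forall>i. i \<notin> V \<longrightarrow> v i = 0) \<and>
        v \<noteq> (\<lambda>i. 0) \<and> (\<forall>u\<in>V. (\<Sum>w\<in>V. a u w * v w) = l * v u))"
      using eigenvalue_adjacency_matrix_iff[OF assms(5), of l] unfolding V_def a_def adj_def .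
    then show ?thesis
      unfolding assms(6)[symmetric] spectrum_def mem_Collect_eq vanishing_def shifted_iff .
  qed
  obtain z where z: "vanishing z" "z \<noteq> (\<lambda>i. 0)" "shifted s z = (\<lambda>i. 0)" using spec[of s] by blast
  have eig_in: "l \<in> {s, 1, -t}" if "vanishing v" "v \<noteq> (\<lambda>i. 0)" "shifted l v = (\<lambda>i. 0)" for v l
    using spec that by blast
  have less: "1 < s" "- t < s" using assms(7,8) by simp_all
  have "\<exists>\<alpha>. (\<forall>i\<in>V. 0 < \<alpha> i) \<and> (\<forall>i\<in>V. (\<Sum>j\<in>V. a i j * \<alpha> j) = s * \<alpha> i) \<and>
      (\<forall>i\<in>V. \<forall>j\<in>V. (\<Sum>k\<in>V. a i k * a k j) - (1 + - t) * a i j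
        + (if i = j then 1 * - t else 0) = \<alpha> i * \<alpha> j)"
    by (rule three_eigenvalues_rank_one[OF eig_in z less])
  then obtain \<alpha> where \<alpha>_pos: "\<And>i. i \<in> V \<Longrightarrow> 0 < \<alpha> i"
    and eig: "\<And>i. i \<in> V \<Longrightarrow> (\<Sum>j\<in>V. a i j * \<alpha> j) = s * \<alpha> i"
    and rank: "\<And>i j. i \<in> V \<Longrightarrow> j \<in> V \<Longrightarrow>
      (\<Sum>k\<in>V. a i k * a k j) - (1 + - t) * a i j + (if i = j then 1 * - t else 0) = \<alpha> i * \<alpha> j"
    by blast
  define nb where "nb = (\<lambda>u. {w \<in> V. adj u w})"
  have card_common: "real (card (nb i \<inter> nb j)) = (\<Sum>k\<in>V. a i k * a k j)" for i j
  proof -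
    have "(\<Sum>k\<in>V. a i k * a k j) = (\<Sum>k\<in>V. of_bool (k \<in> nb i \<inter> nb j))"
      using adj_sym by (intro sum.cong) (auto simp: a_def nb_def)
    also have "\<dots> = real (card (V \<inter> (nb i \<inter> nb j)))"
      using fin by (simp add: sum.If_cases of_bool_def Int_def)
    also have "V \<inter> (nb i \<inter> nb j) = nb i \<inter> nb j" by (auto simp: nb_def)
    finally show ?thesis by simp
  qed
  have degree: "real (card (nb i)) = t + (\<alpha> i)\<^sup>2" if "i \<in> V" for i
    using rank[OF that that] card_common[of i i] adj_irrefl[of i] by (simp add: a_def power2_eq_square)
  have common_adj: "real (card (nb i \<inter> nb j)) = \<alpha> i * \<alpha> j + 1 - t" if "i \<in> V" "j \<in> V" "adj i j" for i j
  proof -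
    have "i \<noteq> j" using that(3) adj_irrefl by blast
    then show ?thesis
      using rank[OF that(1,2)] card_common[of i j] that(3) by (simp add: a_def algebra_simps)
  qed
  have common_nonadj: "real (card (nb i \<inter> nb j)) = \<alpha> i * \<alpha> j" if "i \<in> V" "j \<in> V" "i \<noteq> j" "\<not> adj i j" for i j
    using rank[OF that(1,2)] card_common[of i j] that(3,4) by (simp add: a_def)
  have eigen: "(\<Sum>w\<in>nb i. \<alpha> w) = s * \<alpha> i" if "i \<in> V" for i
    using eig[OF that] fin by (simp add: a_def nb_def sum.inter_filter of_bool_def if_distribR if_distrib cong: if_cong)
  have out_degree: "out_degree \<Gamma> i = card (nb i)" for i
    by (simp add: out_degree_eq_card nb_def V_def adj_def)
  have "V \<noteq> {}" using z(1,2) by (auto simp: vanishing_def fun_eq_iff)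
  then have "min_valency \<Gamma> \<in> valencies \<Gamma>"
    unfolding min_valency_def valencies_def using fin by (intro Min_in) (auto simp: V_def)
  then obtain x where x: "x \<in> V" "card (nb x) = min_valency \<Gamma>"
    by (auto simp: valencies_def V_def out_degree)
  have deg_gt: "card (nb i) > 7" if "i \<in> V" for i
  proof -
    have "real (card (nb i)) > 7"
      using degree[OF that] zero_less_power[OF \<alpha>_pos[OF that], of 2] assms(1) by linarith
    then show ?thesis by simp
  qed
  \<comment> \<open>For an adjacent pair the square of \<open>\<alpha> x * \<alpha> y\<close> has
    two expressions in which the terms quadratic in \<open>t\<close> cancel. A linear equation with
    integer coefficients remains; the valencies above 7 keep its leading coefficient positive even
    when \<open>c\<close> is -1.\<close>
  have t_rat: "t \<in> \<rat>"
  proof -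
    have "nb x \<noteq> {}" using deg_gt[OF x(1)] by force
    then obtain y where y: "y \<in> V" "adj x y" by (auto simp: nb_def)
    define d where "d = real (card (nb x))"
    define e where "e = real (card (nb y))"
    define c where "c = real (card (nb x \<inter> nb y)) - 1"
    have "(d - t) * (e - t) = (c + t)\<^sup>2"
      using degree[OF x(1)] degree[OF y(1)] common_adj[OF x(1) y]
      by (simp add: d_def e_def c_def power_mult_distrib)
    then have "t * (d + e + 2 * c) = d * e - c\<^sup>2" by (simp add: algebra_simps power2_eq_square)
    moreover have "d + e + 2 * c > 0"
      using deg_gt[OF x(1)] deg_gt[OF y(1)] by (simp add: d_def e_def c_def)
    ultimately have "t = (d * e - c\<^sup>2) / (d + e + 2 * c)" by (simp add: field_simps)
    also have "\<dots> \<in> \<rat>" by (simp add: d_def e_def c_def)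
    finally show ?thesis .
  qed
  have t_int: "t \<in> \<int>"
  proof -
    \<comment> \<open>A nonadjacent pair exists because the graph is not a cone. Its
      common-neighbour count does not involve \<open>t\<close>, so the equation below stays monic
      quadratic.\<close>
    have "\<exists>y\<in>V. y \<noteq> x \<and> \<not> adj x y"
    proof (rule ccontr)
      assume "\<not> ?thesis"
      then have "nb x = V - {x}" using adj_irrefl by (auto simp: nb_def)
      then have "card (nb x) = card V - 1" using x(1) fin by simp
      then show False using assms(9) x(1) by (auto simp: cone_graph_def out_degree V_def)
    qed
    then obtain y where y: "y \<in> V" "x \<noteq> y" "\<not> adj x y" by blast
    define d where "d = int (card (nb x))"
    define e where "e = int (card (nb y))"
    define c where "c = int (card (nb x \<inter> nb y))"
    have "(of_int d - t) * (of_int e - t) = (of_int c)\<^sup>2"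
      using degree[OF x(1)] degree[OF y(1)] common_nonadj[OF x(1) y]
      by (simp add: d_def e_def c_def power_mult_distrib)
    then have "t\<^sup>2 + of_int (- (d + e)) * t + of_int (d * e - c\<^sup>2) = 0"
      by (simp add: algebra_simps power2_eq_square)
    then show ?thesis using rational_root_monic_quadratic_int[OF t_rat] by blast
  qed
  \<comment> \<open>The square of \<open>\<alpha> x\<close> is the valency of \<open>x\<close> minus
    \<open>t\<close>, a positive integer below 2 by the assumption on the minimum valency.\<close>
  have \<alpha>_x: "\<alpha> x = 1"
  proof -
    have "(\<alpha> x)\<^sup>2 \<in> \<int>"
      using degree[OF x(1)] t_int by (metis Ints_diff Ints_of_nat add_diff_cancel_left')
    then obtain k :: int where k: "(\<alpha> x)\<^sup>2 = of_int k" by (auto elim: Ints_cases)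
    have "0 < (\<alpha> x)\<^sup>2" "(\<alpha> x)\<^sup>2 < 2"
      using degree[OF x(1)] \<alpha>_pos[OF x(1)] x(2) min_less by simp_all
    then have "k = 1" unfolding k by simp
    then show ?thesis using k \<alpha>_pos[OF x(1)] by (simp add: power2_eq_1_iff)
  qed
  \<comment> \<open>As \<open>\<alpha> x = 1\<close>, the value \<open>\<alpha> i\<close> differs by
    an integer from the number of common neighbours with \<open>x\<close>.\<close>
  have \<alpha>_int: "\<alpha> i \<in> \<int>" if i: "i \<in> V" for i
  proof -
    consider "i = x" | "adj x i" | "i \<noteq> x" "\<not> adj x i" by blast
    then show ?thesis
    proof cases
      case 1
      then show ?thesis using \<alpha>_x by simp
    next
      case 2
      then have "\<alpha> i = real (card (nb x \<inter> nb i)) - 1 + t"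
        using common_adj[OF x(1) i] \<alpha>_x by simp
      then show ?thesis using t_int by simp
    next
      case 3
      then have "\<alpha> i = real (card (nb x \<inter> nb i))"
        using common_nonadj[OF x(1) i] \<alpha>_x by simp
      then show ?thesis by simp
    qed
  qed
  have s_int: "s \<in> \<int>"
  proof -
    have "s = (\<Sum>w\<in>nb x. \<alpha> w)" using eigen[OF x(1)] \<alpha>_x by simp
    also have "\<dots> \<in> \<int>" using \<alpha>_int by (intro Ints_sum) (auto simp: nb_def)
    finally show ?thesis .
  qed
  \<comment> \<open>The floor is exact on \<open>V\<close> and only changes the type.\<close>
  define \<beta> where "\<beta> = (\<lambda>i. \<lfloor>\<alpha> i\<rfloor>)"
  obtain t' :: int where t': "t = of_int t'" using t_int by (rule Ints_cases)
  obtain s' :: int where s': "s = of_int s'" using s_int by (rule Ints_cases)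
  have \<beta>: "\<alpha> i = of_int (\<beta> i)" if "i \<in> V" for i
    using \<alpha>_int[OF that] by (auto simp: \<beta>_def elim: Ints_cases)
  have deg_\<beta>: "int (card (nb i)) = t' + (\<beta> i)\<^sup>2" if "i \<in> V" for i
  proof -
    have "real_of_int (int (card (nb i))) = of_int (t' + (\<beta> i)\<^sup>2)"
      using degree[OF that] by (simp add: \<beta>[OF that] t')
    then show ?thesis unfolding of_int_eq_iff .
  qed
  interpret G: rank_one_graph_small V adj \<beta> s' t' x
  proof
    show "7 \<le> t'" using assms(1) unfolding t' by simp
    show "1 \<le> \<beta> u" if "u \<in> V" for u using \<alpha>_pos[OF that] unfolding \<beta>[OF that] by simp
    show "int (card {w \<in> V. adj u w}) = t' + (\<beta> u)\<^sup>2" if "u \<in> V" for u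
      using deg_\<beta>[OF that] by (simp add: nb_def)
    show "int (card ({w \<in> V. adj u w} \<inter> {w \<in> V. adj v w})) = \<beta> u * \<beta> v + 1 - t'"
      if "u \<in> V" "v \<in> V" "adj u v" for u v
    proof -
      have "real_of_int (int (card (nb u \<inter> nb v))) = of_int (\<beta> u * \<beta> v + 1 - t')"
        using common_adj[OF that] by (simp add: \<beta>[OF that(1)] \<beta>[OF that(2)] t')
      then show ?thesis unfolding of_int_eq_iff nb_def .
    qed
    show "int (card ({w \<in> V. adj u w} \<inter> {w \<in> V. adj v w})) = \<beta> u * \<beta> v"
      if "u \<in> V" "v \<in> V" "u \<noteq> v" "\<not> adj u v" for u v
    proof -
      have "real_of_int (int (card (nb u \<inter> nb v))) = of_int (\<beta> u * \<beta> v)"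
        using common_nonadj[OF that] by (simp add: \<beta>[OF that(1)] \<beta>[OF that(2)])
      then show ?thesis unfolding of_int_eq_iff nb_def .
    qed
    show "(\<Sum>w\<in>{w \<in> V. adj u w}. \<beta> w) = s' * \<beta> u" if "u \<in> V" for u
    proof -
      have "(\<Sum>w\<in>nb u. \<alpha> w) = of_int (\<Sum>w\<in>nb u. \<beta> w)"
        unfolding of_int_sum by (intro sum.cong) (auto simp: nb_def \<beta>)
      then have "real_of_int (\<Sum>w\<in>nb u. \<beta> w) = of_int (s' * \<beta> u)"
        using eigen[OF that] by (simp add: \<beta>[OF that] s')
      then show ?thesis unfolding of_int_eq_iff nb_def .
    qed
    show "\<beta> x = 1" using \<alpha>_x by (simp add: \<beta>_def)
  qed (use fin adj_sym adj_irrefl x(1) in auto)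
  obtain c where c: "\<And>v. v \<in> V \<Longrightarrow> \<beta> v = 1 \<or> \<beta> v = c" using G.only_two_values by blast
  \<comment> \<open>Two values of \<beta> allow at most two valencies; as the graph is not
    biregular, a single one remains, against nonregularity.\<close>
  have "valencies \<Gamma> \<subseteq> {nat (t' + 1), nat (t' + c\<^sup>2)}"
  proof
    fix k assume "k \<in> valencies \<Gamma>"
    then obtain v where v: "v \<in> V" "k = card (nb v)" by (auto simp: valencies_def V_def out_degree)
    then have "k = nat (t' + (\<beta> v)\<^sup>2)" using deg_\<beta>[OF v(1)] by linarith
    then show "k \<in> {nat (t' + 1), nat (t' + c\<^sup>2)}" using c[OF v(1)] by auto
  qed
  then have "card (valencies \<Gamma>) \<le> card {nat (t' + 1), nat (t' + c\<^sup>2)}" by (intro card_mono) auto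
  also have "\<dots> \<le> 2" by (simp add: card_insert_if)
  finally have "card (valencies \<Gamma>) \<le> 2" .
  moreover have "card (valencies \<Gamma>) \<noteq> 2" using assms(10) by (simp add: biregular_graph_def)
  ultimately have "card (valencies \<Gamma>) \<le> Suc 0" by simp
  moreover have "finite (valencies \<Gamma>)" using fin by (simp add: valencies_def V_def)
  ultimately have "\<forall>k\<in>valencies \<Gamma>. \<forall>l\<in>valencies \<Gamma>. k = l" using card_le_Suc0_iff_eq by blast
  then have "\<forall>v\<in>verts \<Gamma>. out_degree \<Gamma> v = out_degree \<Gamma> x"
    using x(1) unfolding valencies_def V_def by blast
  then show False using assms(4) by (auto simp: regular_graph_def)
qed

end
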